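(* For every sufficiently small $\varepsilon>0$ there exists $\beta>0$ such that the following holds. Let $\alpha\ge1500\varepsilon^{-2}$, let $G$ be an $\alpha$-pseudo-random graph on vertex set $[n]$, let $v_0\in[n]$, and let $L_2=(2+\varepsilon)n\ln n$. Then with high probability the trace $\Gamma=\Gamma^{v_0}_{L_2}(G)$ of a $\frac12$-lazy random walk of length $L_2$ on $G$ starting at $v_0$ has the properties: (E1) every $A\subseteq[n]$ with $|A|\le\frac n{\ln n}$ satisfies $|N_\Gamma(A)|\ge|A|\beta\ln n$; (E2) there is an edge of $\Gamma$ between every pair of disjoint $A,B\subseteq[n]$ with $|A|,|B|\ge\frac{n(\ln\ln n)^{1.5}}{\ln n}$.
   Context: A graph $G$ on $[n]$ is $\alpha$-pseudo-random (for $\alpha=\alpha(n)>0$) if: (P1) $G$ is connected; (P2) for every $v$, $|d(v)-\alpha\ln n|\le2\sqrt\alpha\ln n$ and $\frac{5\alpha}{6}\ln n\le d(v)\le\frac{4\alpha}{3}\ln n$; (P3) for every non-empty $S\subseteq[n]$ with $|S|\le0.8n$, $|\partial S|>\frac{|S||S^c|\alpha\ln n}{2n}$; (P4) for every large enough constant $K>0$ and every non-empty $A$ with $|A|=a$: if $\frac n{\alpha\ln n}\le a\le\frac n{\ln n}$ then $|E(A,\{u\in N(A):|E(u,A)|\ge Ka\alpha\ln n/n\})|\le a\alpha\ln n/K$, and if $a<\frac n{\alpha\ln n}$ then $|E(A,\{u\in N(A):|E(u,A)|\ge K\})|\le a\alpha\ln n/\ln K$; (P5) for every $A$ with $|A|=n(\ln\ln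 n)^{1.5}/\ln n$ at most $|A|/2$ vertices $v\notin A$ have $|E(v,A)|\le\alpha(\ln\ln n)^{1.5}/2$; (P6) if $\alpha<\ln^2n$ then for every $v$, every $0\le r\le\frac{\ln n}{15\ln\ln n}$ and every $w\in N(v,r)$, $|E(w,B(v,r))|\le5$. Here $E(A,B)$ is the set of edges between $A$ and $B$, $N(A)$ the external neighbourhood, $\partial S$ the edge boundary, $B(v,r)$ the ball of radius $r$ around $v$ in graph distance, $N(v,r)=B(v,r)\setminus B(v,r-1)$. A $\frac12$-lazy random walk stays put with probability $1/2$ at each step and otherwise moves to a uniformly random neighbour. The trace is the multigraph on $[n]$ of traversed edges (loops included); $N_\Gamma(A)$ is the set of vertices outside $A$ with a $\Gamma$-neighbour in $A$. "With high probability" means with probability tending to $1$ as $n\to\infty$ (for any sequence of such $G$ and $v_0$). *)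

theory Defs
  imports "HOL-Probability.Probability" "HOL-Library.Multiset" "HOL-Library.Extended_Nat"
begin

text \<open>A simple graph on the vertex set \<open>{1..n}\<close> is given by its set of edges, each edge being a
  two-element set of vertices. The notions that only refer to adjacency are stated for arbitrary
  sets of edges and are also used for the set of edges underlying a trace, where a loop at \<open>v\<close>
  is the singleton \<open>{v}\<close>.\<close>

definition simple_graph :: "nat \<Rightarrow> nat set set \<Rightarrow> bool" where
  "simple_graph n E \<longleftrightarrow> E \<subseteq> {{u, v} | u v. u \<in> {1..n} \<and> v \<in> {1..n} \<and> u \<noteq> v}"

definition adj :: "nat set set \<Rightarrow> (nat \<times> nat) set" where
  "adj E = {(u, v). {u, v} \<in> E}"

definition nbrs :: "nat set set \<Rightarrow> nat \<Rightarrow> nat set" where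
  "nbrs E v = {u. {v, u} \<in> E}"

definition deg :: "nat set set \<Rightarrow> nat \<Rightarrow> nat" where
  "deg E v = card (nbrs E v)"

definition edges_between :: "nat set set \<Rightarrow> nat set \<Rightarrow> nat set \<Rightarrow> nat set set" where
  "edges_between E A B = {e \<in> E. \<exists>a\<in>A. \<exists>b\<in>B. e = {a, b}}"

definition ext_nbhd :: "nat \<Rightarrow> nat set set \<Rightarrow> nat set \<Rightarrow> nat set" where
  "ext_nbhd n E A = {u \<in> {1..n} - A. \<exists>a\<in>A. {u, a} \<in> E}"

definition edge_boundary :: "nat \<Rightarrow> nat set set \<Rightarrow> nat set \<Rightarrow> nat set set" where
  "edge_boundary n E S = edges_between E S ({1..n} - S)"

definition connected_graph :: "nat \<Rightarrow> nat set set \<Rightarrow> bool" where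
  "connected_graph n E \<longleftrightarrow> (\<forall>u\<in>{1..n}. \<forall>v\<in>{1..n}. (u, v) \<in> (adj E)\<^sup>*)"

text \<open>The infimum is \<open>\<infinity>\<close> if no walk joins the two vertices.\<close>

definition gdist :: "nat set set \<Rightarrow> nat \<Rightarrow> nat \<Rightarrow> enat" where
  "gdist E u v = Inf {enat k | k. (u, v) \<in> adj E ^^ k}"

definition gball :: "nat \<Rightarrow> nat set set \<Rightarrow> nat \<Rightarrow> nat \<Rightarrow> nat set" where
  "gball n E v r = {u \<in> {1..n}. gdist E v u \<le> enat r}"

text \<open>The case distinction accounts for the empty ball of radius \<open>-1\<close>.\<close>

definition gsphere :: "nat \<Rightarrow> nat set set \<Rightarrow> nat \<Rightarrow> nat \<Rightarrow> nat set" where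
  "gsphere n E v r = (if r = 0 then gball n E v 0 else gball n E v r - gball n E v (r - 1))"


definition P1 :: "nat \<Rightarrow> nat set set \<Rightarrow> bool" where
  "P1 n E \<longleftrightarrow> connected_graph n E"

definition P2 :: "real \<Rightarrow> nat \<Rightarrow> nat set set \<Rightarrow> bool" where
  "P2 \<alpha> n E \<longleftrightarrow> (\<forall>v\<in>{1..n}.
     \<bar>real (deg E v) - \<alpha> * ln (real n)\<bar> \<le> 2 * sqrt \<alpha> * ln (real n) \<and>
     5 * \<alpha> / 6 * ln (real n) \<le> real (deg E v) \<and> real (deg E v) \<le> 4 * \<alpha> / 3 * ln (real n))"

definition P3 :: "real \<Rightarrow> nat \<Rightarrow> nat set set \<Rightarrow> bool" where
  "P3 \<alpha> n E \<longleftrightarrow> (\<forall>S. S \<subseteq> {1..n} \<and> S \<noteq> {} \<and> real (card S) \<le> 8 / 10 * real n \<longrightarrow>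
     real (card (edge_boundary n E S)) >
       real (card S) * real (card ({1..n} - S)) * \<alpha> * ln (real n) / (2 * real n))"

text \<open>``For every large enough constant \<open>K\<close>'' is read as ``for every \<open>K \<ge> K0\<close>'', with a threshold
  \<open>K0\<close> that is a parameter of the property. For a threshold chosen separately for each
  graph the condition would be void: once \<open>K\<close> is larger than all the numbers of edges
  concerned, the sets in question are empty.\<close>

definition P4 :: "real \<Rightarrow> real \<Rightarrow> nat \<Rightarrow> nat set set \<Rightarrow> bool" where
  "P4 K0 \<alpha> n E \<longleftrightarrow> (\<forall>K\<ge>K0. \<forall>A. A \<subseteq> {1..n} \<and> A \<noteq> {} \<longrightarrow>
     (let a = real (card A) in
      (real n / (\<alpha> * ln (real n)) \<le> a \<and> a \<le> real n / ln (real n) \<longrightarrow>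
         real (card (edges_between E A {u \<in> ext_nbhd n E A.
             real (card (edges_between E {u} A)) \<ge> K * a * \<alpha> * ln (real n) / real n}))
           \<le> a * \<alpha> * ln (real n) / K) \<and>
      (a < real n / (\<alpha> * ln (real n)) \<longrightarrow>
         real (card (edges_between E A {u \<in> ext_nbhd n E A.
             real (card (edges_between E {u} A)) \<ge> K}))
           \<le> a * \<alpha> * ln (real n) / ln K)))"

definition large_size :: "nat \<Rightarrow> real" where
  "large_size n = real n * ln (ln (real n)) powr (3 / 2) / ln (real n)"

text \<open>The prescribed size of \<open>A\<close> is in general not an integer and is rounded up; without
  rounding the condition would be void for almost all \<open>n\<close>.\<close>

definition P5 :: "real \<Rightarrow> nat \<Rightarrow> nat set set \<Rightarrow> bool" where
  "P5 \<alpha> n E \<longleftrightarrow> (\<forall>A. A \<subseteq> {1..n} \<and> int (card A) = \<lceil>large_size n\<rceil> \<longrightarrow>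
     real (card {v \<in> {1..n} - A.
         real (card (edges_between E {v} A)) \<le> \<alpha> * ln (ln (real n)) powr (3 / 2) / 2})
       \<le> real (card A) / 2)"

definition P6 :: "real \<Rightarrow> nat \<Rightarrow> nat set set \<Rightarrow> bool" where
  "P6 \<alpha> n E \<longleftrightarrow> (\<alpha> < (ln (real n))\<^sup>2 \<longrightarrow>
     (\<forall>v\<in>{1..n}. \<forall>r::nat. real r \<le> ln (real n) / (15 * ln (ln (real n))) \<longrightarrow>
        (\<forall>w\<in>gsphere n E v r. card (edges_between E {w} (gball n E v r)) \<le> 5)))"

definition pseudo_random :: "real \<Rightarrow> real \<Rightarrow> nat \<Rightarrow> nat set set \<Rightarrow> bool" where
  "pseudo_random K0 \<alpha> n E \<longleftrightarrow> \<alpha> > 0 \<and> simple_graph n E \<and>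
     P1 n E \<and> P2 \<alpha> n E \<and> P3 \<alpha> n E \<and> P4 K0 \<alpha> n E \<and> P5 \<alpha> n E \<and> P6 \<alpha> n E"


text \<open>This is only meaningful at vertices with at least one and finitely many neighbours, hence at
  every vertex of a connected graph on \<open>{1..n}\<close> with \<open>n \<ge> 2\<close>.\<close>

definition lazy_step :: "nat set set \<Rightarrow> nat \<Rightarrow> nat pmf" where
  "lazy_step E v =
     bind_pmf (bernoulli_pmf (1 / 2)) (\<lambda>stay. if stay then return_pmf v else pmf_of_set (nbrs E v))"

text \<open>The distribution of the list \<open>[X\<^sub>0, \<dots>, X\<^sub>L]\<close> of positions of the walk with \<open>L\<close> steps and
  \<open>X\<^sub>0 = v\<close>.\<close>

primrec lazy_walk :: "nat set set \<Rightarrow> nat \<Rightarrow> nat \<Rightarrow> nat list pmf" where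
  "lazy_walk E v 0 = return_pmf [v]"
| "lazy_walk E v (Suc L) = bind_pmf (lazy_step E v) (\<lambda>u. map_pmf ((#) v) (lazy_walk E u L))"

text \<open>The multiset of the traversed edges \<open>{X\<^sub>i, X\<^sub>i\<^sub>+\<^sub>1}\<close>.\<close>

definition trace_of :: "nat list \<Rightarrow> nat set multiset" where
  "trace_of xs = mset (map2 (\<lambda>x y. {x, y}) xs (tl xs))"

definition walk_trace :: "nat set set \<Rightarrow> nat \<Rightarrow> nat \<Rightarrow> nat set multiset pmf" where
  "walk_trace E v L = map_pmf trace_of (lazy_walk E v L)"

definition E1 :: "real \<Rightarrow> nat \<Rightarrow> nat set multiset \<Rightarrow> bool" where
  "E1 \<beta> n \<Gamma> \<longleftrightarrow> (\<forall>A. A \<subseteq> {1..n} \<and> real (card A) \<le> real n / ln (real n) \<longrightarrow>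
     real (card (ext_nbhd n (set_mset \<Gamma>) A)) \<ge> real (card A) * \<beta> * ln (real n))"

definition E2 :: "nat \<Rightarrow> nat set multiset \<Rightarrow> bool" where
  "E2 n \<Gamma> \<longleftrightarrow> (\<forall>A B. A \<subseteq> {1..n} \<and> B \<subseteq> {1..n} \<and> A \<inter> B = {} \<and>
     real (card A) \<ge> large_size n \<and> real (card B) \<ge> large_size n \<longrightarrow>
     edges_between (set_mset \<Gamma>) A B \<noteq> {})"

end

theory Submission
  imports Defs "HOL-Real_Asymp.Real_Asymp"
begin

text \<open>Expansion (P3) gives, by Cheeger's inequality, a constant spectral gap, so the walk mixes in
  time \<open>O(ln n)\<close>. Cut the walk into blocks that are long compared with the mixing time. In each block
  it leaves a fixed vertex \<open>v\<close> with probability at least the expected number of departures divided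
  by the expected number given one departure, and the latter is \<open>1 + O(\<epsilon>\<^sup>2)\<close> because all degrees are
  large. By (P2) the number of successful blocks has mean at least \<open>(1 + \<epsilon>/5) ln n\<close>, so with high
  probability every vertex is left at least \<open>\<rho> ln n\<close> times.

  The endpoints of these departures are independent uniform neighbours; an exponential
  supermartingale turns this into union bounds. If (E1) fails for \<open>A\<close>, then at least half of the
  first \<open>|A| \<rho> ln n\<close> departures from \<open>A\<close> end inside \<open>A\<close> or at vertices with many neighbours in \<open>A\<close>,
  which carry a tiny fraction of the edges at \<open>A\<close> by (P4), or they end in a set of at most
  \<open>\<beta> |A| ln n\<close> vertices with few neighbours in \<open>A\<close>. Both are too unlikely to be compensated by the
  number of choices. If (E2) fails for \<open>A\<close> and \<open>B\<close>, then all departures from the vertices of \<open>B\<close>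
  with many neighbours in \<open>A\<close>, which are at least half of \<open>B\<close> by (P5), avoid \<open>A\<close>.\<close>

section \<open>Expansion and the spectral gap\<close>

text \<open>A union bound over all \<open>n\<close> vertices needs each to be left too rarely with
  probability o(1/n). The mean number of departures is about (1 + \<epsilon>/2) ln n, the factor 2
  in the length of the walk being used up by laziness, so all losses together must stay below
  \<epsilon>/2. This explains \<open>1500 / \<epsilon>^2\<close>: when sqrt \<alpha> is at least
  36/\<epsilon>, the degrees are so close that every stationary mass is at least (1 -
  \<epsilon>/9)/n, and \<open>d = \<alpha> ln n\<close> keeps the chance of a return before mixing
  of order \<epsilon>^2. In (E1) the obstacle is that the trace neighbourhood is itself random,
  which forces a union bound over its possible light parts \<open>W\<close>. If \<open>W\<close> has
  relative density z in its host set, there are about z^(-m) choices with m = \<beta> |A| ln n,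
  while half of |A| \<rho> ln n departures hit \<open>W\<close> with probability about (K z)^(|A|
  \<rho> ln n / 2). For \<beta> small against \<rho> the second power wins for every small z, so no
  lower bound on z is needed. The constants are chosen in the order \<rho> from \<epsilon>, then
  \<open>K\<close> from \<rho> and the threshold of (P4), then \<beta> from both.\<close>

lemma coarea_expansion:
  fixes c :: "'a \<Rightarrow> 'a \<Rightarrow> real" and h :: "'a \<Rightarrow> real" and \<kappa> :: real
  assumes fin: "finite V"
    and sym: "\<And>x y. c x y = c y x"
    and exp: "\<And>S. S \<subseteq> V \<Longrightarrow> 2 * card S \<le> card V \<Longrightarrow> \<kappa> * card S \<le> (\<Sum>x\<in>S. \<Sum>y\<in>V - S. c x y)"
    and "\<And>x. x \<in> V \<Longrightarrow> h x \<ge> 0"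
    and "2 * card {x \<in> V. h x > 0} \<le> card V"
  shows "2 * \<kappa> * (\<Sum>x\<in>V. h x) \<le> (\<Sum>x\<in>V. \<Sum>y\<in>V. c x y * \<bar>h x - h y\<bar>)"
  using assms(4,5)
\<comment> \<open>Discrete coarea formula, one level at a time: lowering \<open>h\<close> on its
  support \<open>S\<close> by its least positive value \<open>m\<close> shrinks the support and
  takes exactly \<open>m\<close> from each difference across the cut of \<open>S\<close>. The
  expansion of \<open>S\<close> pays for this, and each cut edge occurs in two orders, hence the
  factor 2.\<close>
proof (induction "card {x \<in> V. h x > 0}" arbitrary: h rule: less_induct)
  case less
  define S where "S = {x \<in> V. h x > 0}"
  have S: "S \<subseteq> V" "finite S" using fin by (auto simp: S_def)
  have h0: "h x = 0" if "x \<in> V - S" for x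
    using less.prems(1)[of x] that by (auto simp: S_def)
  show ?case
  proof (cases "S = {}")
    case True
    then have "h x = 0" if "x \<in> V" for x using h0 that by auto
    then show ?thesis by simp
  next
    case False
    define m where "m = Min (h ` S)"
    have m_le: "m \<le> h x" if "x \<in> S" for x using that S by (auto simp: m_def)
    have "m \<in> h ` S" using Min_in[of "h ` S"] S False by (simp add: m_def)
    then obtain x0 where x0: "x0 \<in> S" "h x0 = m" by blast
    have mpos: "m > 0" using x0 by (auto simp: S_def)
    define h' where "h' = (\<lambda>x. if x \<in> S then h x - m else h x)"
    have h'0: "h' x \<ge> 0" if "x \<in> V" for x
      using less.prems(1)[OF that] m_le[of x] by (auto simp: h'_def)
    have "x \<in> S" if "x \<in> V" "h' x > 0" for x
      using that h0[of x] by (cases "x \<in> S") (simp_all add: h'_def)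
    moreover have "h' x0 = 0" using x0 by (simp add: h'_def)
    ultimately have sub: "{x \<in> V. h' x > 0} \<subset> S"
      using x0(1) by fastforce
    have "card {x \<in> V. h' x > 0} < card S" using sub S by (intro psubset_card_mono)
    then have IH: "2 * \<kappa> * (\<Sum>x\<in>V. h' x) \<le> (\<Sum>x\<in>V. \<Sum>y\<in>V. c x y * \<bar>h' x - h' y\<bar>)"
      using less.hyps[of h'] h'0 less.prems(2) unfolding S_def by fastforce
    define i where "i = (\<lambda>x y. if x \<in> S \<and> y \<in> V - S then c x y else 0)"
    have i_sum: "(\<Sum>x\<in>V. \<Sum>y\<in>V. i x y) = (\<Sum>x\<in>S. \<Sum>y\<in>V - S. c x y)"
    proof -
      have "(\<Sum>x\<in>V. \<Sum>y\<in>V. i x y) = (\<Sum>x\<in>S. \<Sum>y\<in>V. i x y)"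
        by (rule sum.mono_neutral_right) (use S fin in \<open>auto simp: i_def\<close>)
      also have "\<dots> = (\<Sum>x\<in>S. \<Sum>y\<in>V - S. i x y)"
        by (rule sum.cong[OF refl], rule sum.mono_neutral_right) (use S fin in \<open>auto simp: i_def\<close>)
      finally show ?thesis by (simp add: i_def)
    qed
    have i_sum': "(\<Sum>x\<in>V. \<Sum>y\<in>V. i y x) = (\<Sum>x\<in>S. \<Sum>y\<in>V - S. c x y)"
      by (subst sum.swap) (rule i_sum)
    have "c x y * \<bar>h x - h y\<bar> = c x y * \<bar>h' x - h' y\<bar> + m * (i x y + i y x)"
      if "x \<in> V" "y \<in> V" for x y
    proof -
      consider "x \<in> S" "y \<in> S" | "x \<in> S" "y \<notin> S" | "x \<notin> S" "y \<in> S" | "x \<notin> S" "y \<notin> S" by blast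
      then show ?thesis
      proof cases
        case 2
        then show ?thesis using that h0[of y] m_le[of x] mpos
          by (simp add: h'_def i_def algebra_simps)
      next
        case 3
        then show ?thesis using that h0[of x] m_le[of y] mpos sym[of x y]
          by (simp add: h'_def i_def algebra_simps)
      qed (use that in \<open>auto simp: h'_def i_def\<close>)
    qed
    then have "(\<Sum>x\<in>V. \<Sum>y\<in>V. c x y * \<bar>h x - h y\<bar>)
       = (\<Sum>x\<in>V. \<Sum>y\<in>V. c x y * \<bar>h' x - h' y\<bar> + m * (i x y + i y x))"
      by simp
    also have "\<dots> = (\<Sum>x\<in>V. \<Sum>y\<in>V. c x y * \<bar>h' x - h' y\<bar>)
        + m * ((\<Sum>x\<in>V. \<Sum>y\<in>V. i x y) + (\<Sum>x\<in>V. \<Sum>y\<in>V. i y x))"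
      by (simp add: sum.distrib sum_distrib_left distrib_left)
    also have "\<dots> \<ge> 2 * \<kappa> * (\<Sum>x\<in>V. h' x) + m * (2 * (\<kappa> * card S))"
      unfolding i_sum i_sum' using IH exp[of S] S less.prems(2) mpos
      by (intro add_mono mult_left_mono) (auto simp: S_def)
    also have "(\<Sum>x\<in>V. h' x) = (\<Sum>x\<in>V. h x) - m * card S"
    proof -
      have "(\<Sum>x\<in>V. h' x) = (\<Sum>x\<in>V. h x - (if x \<in> S then m else 0))"
        by (intro sum.cong) (auto simp: h'_def)
      also have "\<dots> = (\<Sum>x\<in>V. h x) - (\<Sum>x\<in>V. if x \<in> S then m else 0)"
        by (simp add: sum_subtractf)
      also have "(\<Sum>x\<in>V. if x \<in> S then m else 0) = m * card S"
        using S fin by (simp add: sum.If_cases Int_absorb1)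
      finally show ?thesis .
    qed
    finally show ?thesis by (simp add: algebra_simps)
  qed
qed

text \<open>The coarea bound for \<open>g^2\<close>, whose differences factor as |g x - g y| (g x +
  g y). Cauchy-Schwarz splits off the Dirichlet form, and the other factor is at most
  \<open>4 * D\<close> times the sum of squares.\<close>

lemma cheeger_small_support:
  fixes c :: "'a \<Rightarrow> 'a \<Rightarrow> real" and g :: "'a \<Rightarrow> real" and \<kappa> D :: real
  assumes fin: "finite V"
    and sym: "\<And>x y. c x y = c y x"
    and c0: "\<And>x y. c x y \<ge> 0"
    and exp: "\<And>S. S \<subseteq> V \<Longrightarrow> 2 * card S \<le> card V \<Longrightarrow> \<kappa> * card S \<le> (\<Sum>x\<in>S. \<Sum>y\<in>V - S. c x y)"
    and degree: "\<And>x. x \<in> V \<Longrightarrow> (\<Sum>y\<in>V. c x y) \<le> D"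
    and "D > 0" "\<kappa> > 0"
    and g0: "\<And>x. x \<in> V \<Longrightarrow> g x \<ge> 0"
    and supp: "2 * card {x \<in> V. g x > 0} \<le> card V"
  shows "\<kappa>\<^sup>2 / D * (\<Sum>x\<in>V. (g x)\<^sup>2) \<le> (\<Sum>x\<in>V. \<Sum>y\<in>V. c x y * (g x - g y)\<^sup>2)"
proof -
  let ?N = "\<Sum>x\<in>V. (g x)\<^sup>2"
  let ?A = "\<Sum>(x,y)\<in>V\<times>V. c x y * (g x - g y)\<^sup>2"
  let ?B = "\<Sum>(x,y)\<in>V\<times>V. c x y * (g x + g y)\<^sup>2"
  have host_size: "?N \<ge> 0" by (simp add: sum_nonneg)
  have A0: "?A \<ge> 0" by (auto intro!: sum_nonneg simp: c0)
  have set_eq: "{x \<in> V. (g x)\<^sup>2 > 0} = {x \<in> V. g x > 0}"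
    using g0 by (auto simp: less_le)
  have "2 * \<kappa> * ?N \<le> (\<Sum>x\<in>V. \<Sum>y\<in>V. c x y * \<bar>(g x)\<^sup>2 - (g y)\<^sup>2\<bar>)"
    by (rule coarea_expansion[OF fin sym exp]) (use supp set_eq in auto)
  also have "\<dots> = (\<Sum>(x,y)\<in>V\<times>V. sqrt (c x y) * \<bar>g x - g y\<bar> * (sqrt (c x y) * (g x + g y)))"
    unfolding sum.cartesian_product
  proof (intro sum.cong refl, clarify)
    fix x y assume xy: "x \<in> V" "y \<in> V"
    have "(g x)\<^sup>2 - (g y)\<^sup>2 = (g x - g y) * (g x + g y)" by (simp add: power2_eq_square algebra_simps)
    then have "\<bar>(g x)\<^sup>2 - (g y)\<^sup>2\<bar> = \<bar>g x - g y\<bar> * (g x + g y)"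
      using g0[OF xy(1)] g0[OF xy(2)] by (simp add: abs_mult)
    moreover have "sqrt (c x y) * sqrt (c x y) = c x y" using c0 by simp
    ultimately show "c x y * \<bar>(g x)\<^sup>2 - (g y)\<^sup>2\<bar>
        = sqrt (c x y) * \<bar>g x - g y\<bar> * (sqrt (c x y) * (g x + g y))"
      by (metis mult.assoc mult.left_commute)
  qed
  finally have 1: "2 * \<kappa> * ?N \<le> (\<Sum>(x,y)\<in>V\<times>V. sqrt (c x y) * \<bar>g x - g y\<bar> * (sqrt (c x y) * (g x + g y)))" .
  have "(2 * \<kappa> * ?N)\<^sup>2 \<le> (\<Sum>(x,y)\<in>V\<times>V. sqrt (c x y) * \<bar>g x - g y\<bar> * (sqrt (c x y) * (g x + g y)))\<^sup>2"
    using 1 host_size \<open>\<kappa> > 0\<close> by (intro power_mono) auto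
  also have "\<dots> \<le> (\<Sum>(x,y)\<in>V\<times>V. (sqrt (c x y) * \<bar>g x - g y\<bar>)\<^sup>2) * (\<Sum>(x,y)\<in>V\<times>V. (sqrt (c x y) * (g x + g y))\<^sup>2)"
    using Cauchy_Schwarz_ineq_sum[of "\<lambda>(x,y). sqrt (c x y) * \<bar>g x - g y\<bar>" "\<lambda>(x,y). sqrt (c x y) * (g x + g y)" "V\<times>V"]
    by (simp add: case_prod_unfold)
  also have "\<dots> = ?A * ?B"
    using c0 by (simp add: power_mult_distrib)
  also have "?B \<le> 4 * D * ?N"
  proof -
    have "?B \<le> (\<Sum>(x,y)\<in>V\<times>V. 2 * (c x y * (g x)\<^sup>2) + 2 * (c y x * (g y)\<^sup>2))"
    proof (intro sum_mono, clarify)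
      fix x y
      have "(g x + g y)\<^sup>2 \<le> 2 * (g x)\<^sup>2 + 2 * (g y)\<^sup>2"
        using sum_squares_bound[of "g x" "g y"] by (simp add: power2_sum)
      from mult_left_mono[OF this c0[of x y]]
      show "c x y * (g x + g y)\<^sup>2 \<le> 2 * (c x y * (g x)\<^sup>2) + 2 * (c y x * (g y)\<^sup>2)"
        using sym[of x y] by (simp add: algebra_simps)
    qed
    also have "\<dots> = 2 * (\<Sum>x\<in>V. \<Sum>y\<in>V. c x y * (g x)\<^sup>2) + 2 * (\<Sum>x\<in>V. \<Sum>y\<in>V. c y x * (g y)\<^sup>2)"
      by (simp add: sum.cartesian_product[symmetric] sum.distrib sum_distrib_left)
    also have "(\<Sum>x\<in>V. \<Sum>y\<in>V. c y x * (g y)\<^sup>2) = (\<Sum>x\<in>V. \<Sum>y\<in>V. c x y * (g x)\<^sup>2)"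
      by (rule sum.swap)
    also have "(\<Sum>x\<in>V. \<Sum>y\<in>V. c x y * (g x)\<^sup>2) = (\<Sum>x\<in>V. (\<Sum>y\<in>V. c x y) * (g x)\<^sup>2)"
      by (simp add: sum_distrib_right)
    also have "\<dots> \<le> (\<Sum>x\<in>V. D * (g x)\<^sup>2)"
      by (intro sum_mono mult_right_mono degree) auto
    finally show ?thesis by (simp add: sum_distrib_left[symmetric])
  qed
  finally have 2: "(2 * \<kappa> * ?N)\<^sup>2 \<le> ?A * (4 * D * ?N)" using A0 by (simp add: mult_left_mono)
  have "\<kappa>\<^sup>2 * ?N \<le> ?A * D"
  proof (cases "?N = 0")
    case True
    then show ?thesis using A0 \<open>D > 0\<close> by simp
  next
    case False
    then have "?N > 0" using host_size by linarith
    then show ?thesis using 2 by (simp add: power2_eq_square algebra_simps)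
  qed
  then show ?thesis using \<open>D > 0\<close>
    by (simp add: sum.cartesian_product field_simps)
qed

text \<open>Take the least value of \<open>f\<close> with at most half of the points strictly above
  it. The next smaller value has more than half above it, and those points are disjoint from the
  ones below the median.\<close>

lemma finite_median:
  fixes f :: "'a \<Rightarrow> real"
  assumes "finite V" "V \<noteq> {}"
  obtains m where "2 * card {x \<in> V. f x > m} \<le> card V" "2 * card {x \<in> V. f x < m} \<le> card V"
proof -
  define M where "M = {t \<in> f ` V. 2 * card {x \<in> V. f x > t} \<le> card V}"
  have finM: "finite M" using assms by (auto simp: M_def)
  have "Max (f ` V) \<in> M"
  proof -
    have "{x \<in> V. f x > Max (f ` V)} = {}" using assms by (auto simp del: Max_less_iff Max_gr_iff simp: not_less)
    then have "card {x \<in> V. f x > Max (f ` V)} = 0" by (simp only: card.empty)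
    moreover have "Max (f ` V) \<in> f ` V" using assms by (intro Max_in) auto
    ultimately show ?thesis unfolding M_def by simp
  qed
  then have Mne: "M \<noteq> {}" by blast
  define m where "m = Min M"
  have mM: "m \<in> M" using Min_in[OF finM Mne] by (simp add: m_def)
  have "2 * card {x \<in> V. f x < m} \<le> card V"
  proof (cases "{x \<in> V. f x < m} = {}")
    case True
    then show ?thesis by (simp only: card.empty)
  next
    case False
    define L where "L = {x \<in> V. f x < m}"
    have L: "finite L" "L \<noteq> {}" using False assms by (auto simp: L_def)
    define t where "t = Max (f ` L)"
    have tL: "t \<in> f ` L" using L by (simp add: t_def)
    then have "t < m" "t \<in> f ` V" by (auto simp: L_def)
    then have "t \<notin> M" using Min_le[OF finM, of t] by (auto simp: m_def)
    then have gt: "2 * card {x \<in> V. f x > t} > card V" using \<open>t \<in> f ` V\<close> by (auto simp: M_def)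
    have "L \<inter> {x \<in> V. f x > t} = {}" using L by (auto simp: t_def not_less)
    moreover have "L \<union> {x \<in> V. f x > t} \<subseteq> V" by (auto simp: L_def)
    ultimately have "card L + card {x \<in> V. f x > t} \<le> card V"
      using assms L by (subst card_Un_disjoint[symmetric]) (auto intro: card_mono)
    then show ?thesis using gt unfolding L_def by linarith
  qed
  then show ?thesis using that mM by (auto simp: M_def)
qed

text \<open>Positive and negative part of \<open>f - m\<close> about a median \<open>m\<close> are
  each supported on at most half of the vertices, where expansion is available. Their squares add up
  exactly, and the mixed term of their differences has the favourable sign.\<close>

lemma cheeger:
  fixes c :: "'a \<Rightarrow> 'a \<Rightarrow> real" and f :: "'a \<Rightarrow> real" and \<kappa> D :: real
  assumes fin: "finite V" "V \<noteq> {}"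
    and sym: "\<And>x y. c x y = c y x"
    and c0: "\<And>x y. c x y \<ge> 0"
    and exp: "\<And>S. S \<subseteq> V \<Longrightarrow> 2 * card S \<le> card V \<Longrightarrow> \<kappa> * card S \<le> (\<Sum>x\<in>S. \<Sum>y\<in>V - S. c x y)"
    and degree: "\<And>x. x \<in> V \<Longrightarrow> (\<Sum>y\<in>V. c x y) \<le> D"
    and "D > 0" "\<kappa> > 0"
  obtains m where "\<kappa>\<^sup>2 / D * (\<Sum>x\<in>V. (f x - m)\<^sup>2) \<le> (\<Sum>x\<in>V. \<Sum>y\<in>V. c x y * (f x - f y)\<^sup>2)"
proof -
  obtain m where m: "2 * card {x \<in> V. f x > m} \<le> card V" "2 * card {x \<in> V. f x < m} \<le> card V"
    using finite_median[OF fin] by blast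
  define p where "p = (\<lambda>x. max 0 (f x - m))"
  define q where "q = (\<lambda>x. max 0 (m - f x))"
  have p: "\<kappa>\<^sup>2 / D * (\<Sum>x\<in>V. (p x)\<^sup>2) \<le> (\<Sum>x\<in>V. \<Sum>y\<in>V. c x y * (p x - p y)\<^sup>2)"
    by (rule cheeger_small_support[OF fin(1) sym c0 exp degree]) 
       (use m assms in \<open>auto simp: p_def less_max_iff_disj\<close>)
  have q: "\<kappa>\<^sup>2 / D * (\<Sum>x\<in>V. (q x)\<^sup>2) \<le> (\<Sum>x\<in>V. \<Sum>y\<in>V. c x y * (q x - q y)\<^sup>2)"
    by (rule cheeger_small_support[OF fin(1) sym c0 exp degree]) 
       (use m assms in \<open>auto simp: q_def less_max_iff_disj\<close>)
  have pq: "(f x - m)\<^sup>2 = (p x)\<^sup>2 + (q x)\<^sup>2" for x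
    by (auto simp: p_def q_def max_def power2_eq_square algebra_simps)
  have le: "(p x - p y)\<^sup>2 + (q x - q y)\<^sup>2 \<le> (f x - f y)\<^sup>2" for x y
  proof -
    have f: "f x - f y = (p x - p y) - (q x - q y)" by (auto simp: p_def q_def max_def)
    have "(p x - p y) * (q x - q y) \<le> 0"
    proof -
      have "p x * q x = 0" "p y * q y = 0" "p x * q y \<ge> 0" "p y * q x \<ge> 0"
        by (auto simp: p_def q_def max_def)
      moreover have "(p x - p y) * (q x - q y) = p x * q x - p x * q y - p y * q x + p y * q y"
        by (simp add: algebra_simps)
      ultimately show ?thesis by linarith
    qed
    moreover have "a\<^sup>2 + b\<^sup>2 \<le> (a - b)\<^sup>2" if "a * b \<le> 0" for a b :: real
      using that by (simp add: power2_diff)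
    ultimately show ?thesis unfolding f by blast
  qed
  have "\<kappa>\<^sup>2 / D * (\<Sum>x\<in>V. (f x - m)\<^sup>2) \<le> (\<Sum>x\<in>V. \<Sum>y\<in>V. c x y * ((p x - p y)\<^sup>2 + (q x - q y)\<^sup>2))"
    using p q by (simp add: pq sum.distrib algebra_simps)
  also have "\<dots> \<le> (\<Sum>x\<in>V. \<Sum>y\<in>V. c x y * (f x - f y)\<^sup>2)"
    by (intro sum_mono mult_left_mono le c0)
  finally show ?thesis using that by blast
qed

section \<open>The transition operator of the lazy walk and its contraction in the degree-weighted
  L2 norm\<close>

lemma simple_graphD:
  assumes "simple_graph n E" "{x, y} \<in> E"
  shows "x \<in> {1..n}" "y \<in> {1..n}" "x \<noteq> y"
proof -
  from assms obtain u v where "{x, y} = {u, v}" "u \<in> {1..n}" "v \<in> {1..n}" "u \<noteq> v"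
    unfolding simple_graph_def by blast
  then show "x \<in> {1..n}" "y \<in> {1..n}" "x \<noteq> y" by (auto simp: doubleton_eq_iff)
qed

lemma nbrs_sym: "x \<in> nbrs E y \<longleftrightarrow> y \<in> nbrs E x"
  by (simp add: nbrs_def insert_commute)

lemma card_edges_between_disjoint:
  assumes "finite A" "finite B" "A \<inter> B = {}"
  shows "card (edges_between E A B) = (\<Sum>x\<in>A. card (nbrs E x \<inter> B))"
proof -
  have "edges_between E A B = (\<lambda>(x,y). {x,y}) ` (SIGMA x:A. nbrs E x \<inter> B)"
    by (auto simp: edges_between_def nbrs_def image_iff)
  moreover have "inj_on (\<lambda>(x,y). {x,y}) (SIGMA x:A. nbrs E x \<inter> B)"
    using assms(3) by (auto simp: inj_on_def doubleton_eq_iff)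
  ultimately show ?thesis using assms by (simp add: card_image)
qed

definition lazy_op :: "nat set set \<Rightarrow> (nat \<Rightarrow> real) \<Rightarrow> nat \<Rightarrow> real" where
  "lazy_op E f v = f v / 2 + (\<Sum>u\<in>nbrs E v. f u) / (2 * real (deg E v))"

text \<open>\<open>d\<close> will be \<open>\<alpha> * ln n\<close>; the factors 5/6 and 4/3 are
  those of (P2).\<close>

locale near_regular =
  fixes n :: nat and E :: "nat set set" and d :: real
  assumes simple: "simple_graph n E"
    and n_pos: "0 < n"
    and d_pos: "0 < d"
    and deg_lower: "v \<in> {1..n} \<Longrightarrow> 5 / 6 * d \<le> real (deg E v)"
    and deg_upper: "v \<in> {1..n} \<Longrightarrow> real (deg E v) \<le> 4 / 3 * d"
begin

text \<open>Keeps the simplifier from turning \<open>{1..n}\<close> into \<open>{Suc 0..n}\<close>.\<close>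

declare One_nat_def [simp del]

abbreviation "V \<equiv> {1..n}"
abbreviation "N \<equiv> nbrs E"
abbreviation "P \<equiv> lazy_op E"

lemma nbrs_subset: "N v \<subseteq> V"
  using simple_graphD[OF simple] by (auto simp: nbrs_def)

lemma finite_nbrs [simp]: "finite (N v)"
  by (rule finite_subset[OF nbrs_subset]) simp

lemma not_self_nbr [simp]: "v \<notin> N v"
  using simple_graphD[OF simple, of v v] by (auto simp: nbrs_def)

lemma deg_pos: "v \<in> V \<Longrightarrow> deg E v > 0"
  using deg_lower[of v] d_pos by (cases "deg E v") auto

lemma nbrs_nonempty: "v \<in> V \<Longrightarrow> N v \<noteq> {}"
  using deg_pos[of v] by (auto simp: deg_def)

lemma inv_deg_le: "v \<in> V \<Longrightarrow> 1 / real (deg E v) \<le> 6 / (5 * d)"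
  using deg_lower[of v] d_pos deg_pos[of v] by (simp add: field_simps)

lemma lazy_op_mono:
  assumes "v \<in> V" "\<And>x. x \<in> V \<Longrightarrow> f x \<le> g x"
  shows "P f v \<le> P g v"
proof -
  have "(\<Sum>u\<in>N v. f u) \<le> (\<Sum>u\<in>N v. g u)"
    using assms(2) nbrs_subset by (intro sum_mono) blast
  then show ?thesis unfolding lazy_op_def using assms by (intro add_mono divide_right_mono) auto
qed

lemma lazy_op_const: "v \<in> V \<Longrightarrow> P (\<lambda>_. C) v = C"
  using deg_pos[of v] by (simp add: lazy_op_def deg_def[symmetric])

lemma lazy_op_add: "P (\<lambda>x. f x + g x) v = P f v + P g v"
  by (simp add: lazy_op_def sum.distrib add_divide_distrib)

lemma lazy_op_cmult: "P (\<lambda>x. C * f x) v = C * P f v"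
  by (simp add: lazy_op_def sum_distrib_left[symmetric] algebra_simps)

lemma lazy_op_diff: "P (\<lambda>x. f x - g x) v = P f v - P g v"
  by (simp add: lazy_op_def sum_subtractf diff_divide_distrib)

lemma lazy_op_sum: "P (\<lambda>x. \<Sum>i\<in>I. f i x) v = (\<Sum>i\<in>I. P (f i) v)"
  unfolding lazy_op_def
  by (subst sum.swap) (simp add: sum.distrib sum_divide_distrib)

definition edge_ind :: "nat \<Rightarrow> nat \<Rightarrow> real" where "edge_ind x y = (if y \<in> N x then 1 else 0)"

lemma edge_ind_sym: "edge_ind x y = edge_ind y x"
  by (simp add: edge_ind_def nbrs_sym)

lemma sum_edge_ind: "(\<Sum>y\<in>V. edge_ind x y * f y) = (\<Sum>y\<in>N x. f y)"
proof -
  have "(\<Sum>y\<in>V. edge_ind x y * f y) = (\<Sum>y\<in>V. if y \<in> N x then f y else 0)"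
    by (intro sum.cong) (auto simp: edge_ind_def)
  also have "\<dots> = (\<Sum>y\<in>V \<inter> N x. f y)" by (simp add: sum.inter_restrict)
  also have "V \<inter> N x = N x" using nbrs_subset by blast
  finally show ?thesis .
qed

lemma sum_edge_ind_deg: "(\<Sum>y\<in>V. edge_ind x y) = real (deg E x)"
  using sum_edge_ind[of x "\<lambda>_. 1"] by (simp add: deg_def)

lemma sum_nbrs_swap:
  fixes f :: "nat \<Rightarrow> nat \<Rightarrow> real"
  shows   "(\<Sum>x\<in>V. \<Sum>y\<in>N x. f x y) = (\<Sum>x\<in>V. \<Sum>y\<in>N x. f y x)"
proof -
  have "(\<Sum>x\<in>V. \<Sum>y\<in>N x. f x y) = (\<Sum>x\<in>V. \<Sum>y\<in>V. edge_ind x y * f x y)"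
    by (simp add: sum_edge_ind)
  also have "\<dots> = (\<Sum>x\<in>V. \<Sum>y\<in>V. edge_ind y x * f y x)"
    by (rule sum.swap)
  also have "\<dots> = (\<Sum>x\<in>V. \<Sum>y\<in>V. edge_ind x y * f y x)" by (simp add: edge_ind_sym)
  finally show ?thesis by (simp add: sum_edge_ind)
qed

lemma stationary: "(\<Sum>x\<in>V. real (deg E x) * P f x) = (\<Sum>x\<in>V. real (deg E x) * f x)"
proof -
  have "(\<Sum>x\<in>V. real (deg E x) * P f x)
      = (\<Sum>x\<in>V. real (deg E x) * f x) / 2 + (\<Sum>x\<in>V. \<Sum>y\<in>N x. f y) / 2"
    unfolding sum_divide_distrib[of _ V] sum.distrib[symmetric]
    using deg_pos by (intro sum.cong) (auto simp: lazy_op_def distrib_left)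
  also have "(\<Sum>x\<in>V. \<Sum>y\<in>N x. f y) = (\<Sum>x\<in>V. \<Sum>y\<in>N x. f x)"
    by (rule sum_nbrs_swap)
  also have "\<dots> = (\<Sum>x\<in>V. real (deg E x) * f x)" by (simp add: deg_def)
  finally show ?thesis by simp
qed

definition dirichlet :: "(nat \<Rightarrow> real) \<Rightarrow> real" where
  "dirichlet f = (\<Sum>x\<in>V. \<Sum>y\<in>N x. (f x - f y)\<^sup>2)"

text \<open>Expand the square of f(x)/2 plus half the neighbour average and apply Cauchy-Schwarz to
  that average. Laziness is essential: without the term f(x)/2, eigenvalues near -1 would prevent
  contraction, and the Dirichlet form does not detect them.\<close>

lemma lazy_op_L2:
  "(\<Sum>x\<in>V. real (deg E x) * (P f x)\<^sup>2) \<le> (\<Sum>x\<in>V. real (deg E x) * (f x)\<^sup>2) - dirichlet f / 4"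
proof -
  let ?A = "\<Sum>x\<in>V. real (deg E x) * (f x)\<^sup>2"
  let ?B = "\<Sum>x\<in>V. \<Sum>y\<in>N x. f x * f y"
  have sq: "(\<Sum>x\<in>V. \<Sum>y\<in>N x. (f y)\<^sup>2) = ?A"
    by (subst sum_nbrs_swap) (simp add: deg_def)
  have "dirichlet f = (\<Sum>x\<in>V. \<Sum>y\<in>N x. (f x)\<^sup>2) + (\<Sum>x\<in>V. \<Sum>y\<in>N x. (f y)\<^sup>2) - 2 * ?B"
    unfolding dirichlet_def
    by (simp add: power2_diff sum.distrib sum_subtractf sum_distrib_left mult.assoc)
  then have dir: "dirichlet f = 2 * ?A - 2 * ?B" using sq by (simp add: deg_def)
  have "(\<Sum>x\<in>V. real (deg E x) * (P f x)\<^sup>2)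
     \<le> (\<Sum>x\<in>V. (real (deg E x) * (f x)\<^sup>2 + 2 * (\<Sum>y\<in>N x. f x * f y) + (\<Sum>y\<in>N x. (f y)\<^sup>2)) / 4)"
  proof (rule sum_mono)
    fix x assume x: "x \<in> V"
    let ?S = "\<Sum>y\<in>N x. f y" and ?d = "real (deg E x)"
    have d: "?d > 0" using deg_pos[OF x] by simp
    have "?S\<^sup>2 \<le> ?d * (\<Sum>y\<in>N x. (f y)\<^sup>2)"
      using sum_squared_le_sum_of_squares[of f "N x"] by (simp add: deg_def mult.commute)
    then have S: "?S\<^sup>2 / ?d \<le> (\<Sum>y\<in>N x. (f y)\<^sup>2)" using d by (simp add: field_simps)
    have "?d * (P f x)\<^sup>2 = (?d * (f x)\<^sup>2 + 2 * (f x * ?S) + ?S\<^sup>2 / ?d) / 4"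
      using d by (simp add: lazy_op_def power2_eq_square field_simps)
    also have "\<dots> \<le> (?d * (f x)\<^sup>2 + 2 * (f x * ?S) + (\<Sum>y\<in>N x. (f y)\<^sup>2)) / 4"
      using S by (intro divide_right_mono add_left_mono) auto
    finally show "?d * (P f x)\<^sup>2 \<le> (?d * (f x)\<^sup>2 + 2 * (\<Sum>y\<in>N x. f x * f y) + (\<Sum>y\<in>N x. (f y)\<^sup>2)) / 4"
      by (simp add: sum_distrib_left)
  qed
  also have "\<dots> = (?A + 2 * ?B + ?A) / 4"
    by (simp add: sum_divide_distrib[symmetric] sum.distrib sq sum_distrib_left[symmetric])
  finally have *: "(\<Sum>x\<in>V. real (deg E x) * (P f x)\<^sup>2) \<le> (?A + 2 * ?B + ?A) / 4" .
  have "X \<le> A - D / 4" if "X \<le> (A + 2 * B + A) / 4" "D = 2 * A - 2 * B" for X A B D :: real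
    using that by (simp add: field_simps)
  from this[OF * dir] show ?thesis .
qed

end

text \<open>The factor 1/4 is what (P3) yields when the complement of \<open>S\<close> has at least
  n/2 elements.\<close>

locale expander = near_regular +
  assumes expansion: "S \<subseteq> {1..n} \<Longrightarrow> S \<noteq> {} \<Longrightarrow> 2 * card S \<le> n \<Longrightarrow>
     d / 4 * real (card S) \<le> real (card (edge_boundary n E S))"
begin

lemma cut_lower:
  assumes "S \<subseteq> V" "2 * card S \<le> card V"
  shows "d / 4 * card S \<le> (\<Sum>x\<in>S. \<Sum>y\<in>V - S. edge_ind x y)"
proof (cases "S = {}")
  case False
  have "finite S" using assms finite_subset by blast
  then have "real (card (edge_boundary n E S)) = (\<Sum>x\<in>S. real (card (N x \<inter> (V - S))))"
    unfolding edge_boundary_def by (subst card_edges_between_disjoint) auto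
  also have "\<dots> = (\<Sum>x\<in>S. \<Sum>y\<in>V - S. edge_ind x y)"
  proof (rule sum.cong[OF refl])
    fix x
    have "(\<Sum>y\<in>V - S. edge_ind x y) = (\<Sum>y\<in>(V - S) \<inter> N x. 1)"
      unfolding edge_ind_def by (subst sum.inter_restrict) auto
    then show "real (card (N x \<inter> (V - S))) = (\<Sum>y\<in>V - S. edge_ind x y)" by (simp add: Int_commute)
  qed
  finally show ?thesis using expansion[of S] assms False by simp
qed simp

text \<open>Cheeger with \<kappa> = d/4 and D = 4d/3 gives 3d/64 for the unweighted sum of squares.
  Passing to degree weights divides by 4d/3, leaving 9/256, and \<open>lazy_op_L2\<close>
  contributes a quarter of it.\<close>

lemma contraction:
  assumes mean: "(\<Sum>x\<in>V. real (deg E x) * f x) = 0"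
  shows "(\<Sum>x\<in>V. real (deg E x) * (P f x)\<^sup>2)
    \<le> (1 - 9 / 1024) * (\<Sum>x\<in>V. real (deg E x) * (f x)\<^sup>2)"
proof -
  let ?A = "\<Sum>x\<in>V. real (deg E x) * (f x)\<^sup>2"
  obtain m where m: "(d / 4)\<^sup>2 / (4 / 3 * d) * (\<Sum>x\<in>V. (f x - m)\<^sup>2)
      \<le> (\<Sum>x\<in>V. \<Sum>y\<in>V. edge_ind x y * (f x - f y)\<^sup>2)"
  proof (rule cheeger[of V edge_ind "d / 4" "4 / 3 * d" f])
    show "\<And>x. x \<in> V \<Longrightarrow> sum (edge_ind x) V \<le> 4 / 3 * d" using deg_upper unfolding sum_edge_ind_deg by simp
  qed (use n_pos d_pos edge_ind_sym cut_lower in \<open>auto simp: edge_ind_def\<close>)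
  have dir: "dirichlet f \<ge> 3 * d / 64 * (\<Sum>x\<in>V. (f x - m)\<^sup>2)"
    using m d_pos unfolding dirichlet_def by (simp add: sum_edge_ind power2_eq_square)
  \<comment> \<open>Cheeger centres at a median, but the weighted second moment is least about the
    weighted mean, which is 0.\<close>
  have "?A \<le> ?A + m\<^sup>2 * (\<Sum>x\<in>V. real (deg E x))" by (simp add: sum_nonneg)
  also have "\<dots> = (\<Sum>x\<in>V. real (deg E x) * (f x - m)\<^sup>2)"
  proof -
    have "(\<Sum>x\<in>V. real (deg E x) * (f x - m)\<^sup>2)
        = (\<Sum>x\<in>V. real (deg E x) * (f x)\<^sup>2 + m\<^sup>2 * real (deg E x) - 2 * m * (real (deg E x) * f x))"
      by (intro sum.cong) (auto simp: power2_eq_square algebra_simps)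
    also have "\<dots> = ?A + m\<^sup>2 * (\<Sum>x\<in>V. real (deg E x)) - 2 * m * (\<Sum>x\<in>V. real (deg E x) * f x)"
      by (simp add: sum.distrib sum_subtractf sum_distrib_left)
    finally show ?thesis using mean by simp
  qed
  also have "\<dots> \<le> (\<Sum>x\<in>V. 4 / 3 * d * (f x - m)\<^sup>2)"
    by (intro sum_mono mult_right_mono deg_upper) auto
  also have "\<dots> = 4 / 3 * d * (\<Sum>x\<in>V. (f x - m)\<^sup>2)" by (simp add: sum_distrib_left)
  finally show ?thesis using dir lazy_op_L2[of f] by (simp add: algebra_simps)
qed

definition total :: real where "total = (\<Sum>x\<in>V. real (deg E x))"

lemma total_pos: "total > 0"
  unfolding total_def using n_pos deg_pos by (intro sum_pos) auto

text \<open>Iterated contraction of the indicator of \<open>v\<close> minus its stationary mean,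
  whose initial squared norm is at most deg v. Keeping only the term at \<open>x\<close> in the norm
  gives the pointwise bound; degrees differ by a factor at most 8/5 <= 4, whose root is the
  2.\<close>

lemma mixing:
  assumes "x \<in> V" "v \<in> V"
  shows "\<bar>(P ^^ t) (\<lambda>y. of_bool (y = v)) x - real (deg E v) / total\<bar> \<le> 2 * sqrt ((1 - 9 / 1024) ^ t)"
proof -
  define \<pi> where "\<pi> = real (deg E v) / total"
  define f where "f = (\<lambda>t x. (P ^^ t) (\<lambda>y. of_bool (y = v)) x - \<pi>)"
  have f_Suc: "f (Suc t) x = P (f t) x" if "x \<in> V" for t x
    using that by (simp add: f_def lazy_op_diff lazy_op_const)
  have P_cong: "(\<Sum>x\<in>V. g x (f (Suc t) x)) = (\<Sum>x\<in>V. g x (P (f t) x))" for g :: "nat \<Rightarrow> real \<Rightarrow> real" and t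
    by (intro sum.cong) (auto simp: f_Suc)
  have mean: "(\<Sum>x\<in>V. real (deg E x) * f t x) = 0" for t
  proof (induction t)
    case 0
    have "(\<Sum>x\<in>V. real (deg E x) * f 0 x) = (\<Sum>x\<in>V. real (deg E x) * of_bool (x = v)) - total * \<pi>"
      by (simp add: f_def algebra_simps sum_subtractf total_def sum_distrib_left)
    also have "(\<Sum>x\<in>V. real (deg E x) * of_bool (x = v)) = real (deg E v)"
      using assms by (simp add: of_bool_def if_distrib cong: if_cong)
    finally show ?case using total_pos by (simp add: \<pi>_def)
  next
    case (Suc t)
    then show ?case using stationary[of "f t"] P_cong[of "\<lambda>x z. real (deg E x) * z" t] by simp
  qed
  have L2: "(\<Sum>x\<in>V. real (deg E x) * (f t x)\<^sup>2) \<le> (1 - 9 / 1024) ^ t * real (deg E v)" for t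
  proof (induction t)
    case 0
    have "(\<Sum>x\<in>V. real (deg E x) * (f 0 x)\<^sup>2)
        = (\<Sum>x\<in>V. real (deg E x) * (of_bool (x = v) - \<pi> * of_bool (x = v))) - \<pi> * (\<Sum>x\<in>V. real (deg E x) * f 0 x)"
      unfolding sum_distrib_left sum_subtractf[symmetric]
      by (intro sum.cong) (auto simp: f_def power2_eq_square algebra_simps)
    also have "\<dots> = (\<Sum>x\<in>V. (1 - \<pi>) * (real (deg E x) * of_bool (x = v)))"
      using mean[of 0] by (simp add: algebra_simps)
    also have "\<dots> = (1 - \<pi>) * real (deg E v)"
      using assms by (simp add: sum_distrib_left[symmetric] of_bool_def if_distrib cong: if_cong)
    also have "\<dots> \<le> 1 * real (deg E v)"
      using total_pos by (intro mult_right_mono) (auto simp: \<pi>_def)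
    finally show ?case by simp
  next
    case (Suc t)
    have "(\<Sum>x\<in>V. real (deg E x) * (f (Suc t) x)\<^sup>2) = (\<Sum>x\<in>V. real (deg E x) * (P (f t) x)\<^sup>2)"
      by (rule P_cong[of "\<lambda>x z. real (deg E x) * z\<^sup>2" t])
    also have "\<dots> \<le> (1 - 9 / 1024) * (\<Sum>x\<in>V. real (deg E x) * (f t x)\<^sup>2)"
      by (rule contraction[OF mean])
    also have "\<dots> \<le> (1 - 9 / 1024) * ((1 - 9 / 1024) ^ t * real (deg E v))"
      using Suc by (intro mult_left_mono) auto
    finally show ?case by simp
  qed
  have "real (deg E x) * (f t x)\<^sup>2 \<le> (\<Sum>x\<in>V. real (deg E x) * (f t x)\<^sup>2)"
    using assms by (intro member_le_sum) auto
  also note L2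
  also have "(1 - 9 / 1024) ^ t * real (deg E v) \<le> (1 - 9 / 1024) ^ t * (4 * real (deg E x))"
    using deg_lower[OF assms(1)] deg_upper[OF assms(2)] d_pos by (intro mult_left_mono) auto
  finally have "real (deg E x) * (f t x)\<^sup>2 \<le> real (deg E x) * (4 * (1 - 9 / 1024) ^ t)"
    by (simp add: algebra_simps)
  then have "(f t x)\<^sup>2 \<le> 4 * (1 - 9 / 1024) ^ t"
    using deg_pos[OF assms(1)] by simp
  from real_sqrt_le_mono[OF this] show ?thesis
    by (simp add: f_def \<pi>_def real_sqrt_mult)
qed

end

section \<open>The number of departures from a vertex\<close>

text \<open>Lazy steps at \<open>v\<close> are not recorded, so on a walk every entry stems from a
  step along an edge. The targets are kept in order, so that arguments can be confined to the first
  \<open>k\<close> departures.\<close>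

fun exits :: "nat \<Rightarrow> nat list \<Rightarrow> nat list" where
  "exits v (x # y # xs) = (if x = v \<and> y \<noteq> v then y # exits v (y # xs) else exits v (y # xs))"
| "exits v _ = []"

lemma exits_in_trace: "u \<in> set (exits v xs) \<Longrightarrow> {v, u} \<in> set_mset (trace_of xs)"
  by (induction v xs rule: exits.induct) (auto simp: trace_of_def split: if_splits)

lemma set_lazy_walk_Cons: "xs \<in> set_pmf (lazy_walk E u L) \<Longrightarrow> \<exists>ys. xs = u # ys"
  by (cases L) auto

context near_regular
begin

lemma set_lazy_step: "v \<in> V \<Longrightarrow> set_pmf (lazy_step E v) = insert v (N v)"
  using nbrs_nonempty[of v]
  by (simp add: lazy_step_def set_pmf_bernoulli UNIV_bool Un_commute)

lemma set_lazy_step_subset: "v \<in> V \<Longrightarrow> set_pmf (lazy_step E v) \<subseteq> V"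
  using set_lazy_step[of v] nbrs_subset[of v] by auto

lemma finite_lazy_walk: "v \<in> V \<Longrightarrow> finite (set_pmf (lazy_walk E v L))"
proof (induction L arbitrary: v)
  case (Suc L)
  have "finite (set_pmf (lazy_walk E u L))" if "u \<in> set_pmf (lazy_step E v)" for u
    using Suc.IH that set_lazy_step_subset[OF Suc.prems] by blast
  moreover have "finite (set_pmf (lazy_step E v))"
    by (simp only: set_lazy_step[OF Suc.prems] finite_insert finite_nbrs)
  ultimately show ?case by simp
qed simp

lemma expectation_lazy_step:
  assumes "v \<in> V"
  shows "measure_pmf.expectation (lazy_step E v) f = P f v"
proof -
  have "measure_pmf.expectation (lazy_step E v) f
      = (\<Sum>b\<in>UNIV. pmf (bernoulli_pmf (1 / 2)) b *
           measure_pmf.expectation (if b then return_pmf v else pmf_of_set (N v)) f)"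
    unfolding lazy_step_def using nbrs_nonempty[OF assms]
    by (subst pmf_expectation_bind[where A = UNIV]) auto
  also have "\<dots> = P f v"
    using nbrs_nonempty[OF assms]
    by (simp add: UNIV_bool lazy_op_def integral_pmf_of_set deg_def)
  finally show ?thesis .
qed

text \<open>First-step analysis, the source of the recursions for \<open>laplace\<close> and for
  \<open>exit_weight\<close>.\<close>

lemma expectation_lazy_walk_Suc:
  assumes "v \<in> V"
  shows "measure_pmf.expectation (lazy_walk E v (Suc L)) F
    = P (\<lambda>u. measure_pmf.expectation (lazy_walk E u L) (\<lambda>xs. F (v # xs))) v"
proof -
  have "measure_pmf.expectation (lazy_walk E v (Suc L)) F
      = (\<Sum>u\<in>V. pmf (lazy_step E v) u * measure_pmf.expectation (map_pmf ((#) v) (lazy_walk E u L)) F)"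
    using assms set_lazy_step_subset finite_lazy_walk
    by (simp, subst pmf_expectation_bind[where A = V]) auto
  also have "\<dots> = (\<Sum>u\<in>V. pmf (lazy_step E v) u * measure_pmf.expectation (lazy_walk E u L) (\<lambda>xs. F (v # xs)))"
    by simp
  also have "\<dots> = measure_pmf.expectation (lazy_step E v) (\<lambda>u. measure_pmf.expectation (lazy_walk E u L) (\<lambda>xs. F (v # xs)))"
    by (subst integral_measure_pmf[where A = V]) (use set_lazy_step_subset[OF assms] in \<open>auto simp del: atLeastAtMost_iff\<close>)
  also note expectation_lazy_step[OF assms]
  finally show ?thesis .
qed

lemma expectation_mono:
  fixes F G :: "nat list \<Rightarrow> real"
  assumes "v \<in> V" "\<And>xs. xs \<in> set_pmf (lazy_walk E v L) \<Longrightarrow> F xs \<le> G xs"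
  shows "measure_pmf.expectation (lazy_walk E v L) F \<le> measure_pmf.expectation (lazy_walk E v L) G"
  using assms finite_lazy_walk
  by (intro integral_mono_AE integrable_measure_pmf_finite) (auto simp: AE_measure_pmf_iff)

lemma expectation_cong:
  fixes F G :: "nat list \<Rightarrow> real"
  assumes "\<And>xs. xs \<in> set_pmf (lazy_walk E v L) \<Longrightarrow> F xs = G xs"
  shows "measure_pmf.expectation (lazy_walk E v L) F = measure_pmf.expectation (lazy_walk E v L) G"
  using assms by (intro integral_cong_AE) (auto simp: AE_measure_pmf_iff)

text \<open>The probability generating function of the number of departures. Values of \<theta>
  below 1 serve for lower-tail estimates.\<close>

definition laplace :: "nat \<Rightarrow> real \<Rightarrow> nat \<Rightarrow> nat \<Rightarrow> real" where
  "laplace v \<theta> L x = measure_pmf.expectation (lazy_walk E x L) (\<lambda>xs. \<theta> ^ length (exits v xs))"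

lemma laplace_0: "laplace v \<theta> 0 x = 1"
  by (simp add: laplace_def)

lemma laplace_Suc:
  assumes "x \<in> V"
  shows "laplace v \<theta> (Suc L) x =
    P (\<lambda>u. (if x = v \<and> u \<noteq> v then \<theta> else 1) * laplace v \<theta> L u) x"
proof -
  have "measure_pmf.expectation (lazy_walk E u L) (\<lambda>xs. \<theta> ^ length (exits v (x # xs)))
      = measure_pmf.expectation (lazy_walk E u L)
          (\<lambda>xs. (if x = v \<and> u \<noteq> v then \<theta> else 1) * \<theta> ^ length (exits v xs))" for u
    by (rule expectation_cong) (auto dest!: set_lazy_walk_Cons)
  then show ?thesis
    unfolding laplace_def by (subst expectation_lazy_walk_Suc[OF assms]) simp
qed

lemma laplace_nonneg: "0 \<le> \<theta> \<Longrightarrow> 0 \<le> laplace v \<theta> L x"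
  unfolding laplace_def by (intro integral_nonneg_AE) auto

text \<open>Markov property at time \<open>s\<close>: wherever the walk then is, the remaining
  \<open>L\<close> steps contribute at most the worst-case factor \<open>M\<close>.\<close>

lemma laplace_submult:
  assumes "0 \<le> \<theta>" "x \<in> V" "\<And>u. u \<in> V \<Longrightarrow> laplace v \<theta> L u \<le> M"
  shows "laplace v \<theta> (s + L) x \<le> M * laplace v \<theta> s x"
  using assms(2)
proof (induction s arbitrary: x)
  case 0
  then show ?case using assms by (simp add: laplace_0)
next
  case (Suc s)
  let ?w = "\<lambda>u. if x = v \<and> u \<noteq> v then \<theta> else 1"
  have "laplace v \<theta> (Suc s + L) x = P (\<lambda>u. ?w u * laplace v \<theta> (s + L) u) x"
    using laplace_Suc[OF Suc.prems, of v \<theta> "s + L"] by simp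
  also have "\<dots> \<le> P (\<lambda>u. M * (?w u * laplace v \<theta> s u)) x"
  proof (rule lazy_op_mono[OF Suc.prems])
    fix u assume "u \<in> V"
    from mult_left_mono[OF Suc.IH[OF this], of "?w u"]
    show "?w u * laplace v \<theta> (s + L) u \<le> M * (?w u * laplace v \<theta> s u)"
      using assms(1) by (auto simp: algebra_simps)
  qed
  also have "\<dots> = M * laplace v \<theta> (Suc s) x"
    by (simp only: lazy_op_cmult laplace_Suc[OF Suc.prems])
  finally show ?case .
qed

text \<open>As \<open>0 ^ 0 = 1\<close>, the value at \<open>\<theta> = 0\<close> is the probability of never leaving \<open>v\<close>.\<close>

lemma laplace_le_avoid:
  assumes "x \<in> V" "0 \<le> \<theta>" "\<theta> \<le> 1"
  shows "laplace v \<theta> L x \<le> 1 - (1 - \<theta>) * (1 - laplace v 0 L x)"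
proof -
  have int: "integrable (measure_pmf (lazy_walk E x L)) f" for f :: "nat list \<Rightarrow> real"
    using finite_lazy_walk[OF assms(1)] by (rule integrable_measure_pmf_finite)
  have "laplace v \<theta> L x \<le> measure_pmf.expectation (lazy_walk E x L)
      (\<lambda>xs. \<theta> + (1 - \<theta>) * 0 ^ length (exits v xs))"
    unfolding laplace_def
  proof (rule expectation_mono[OF assms(1)])
    fix xs
    show "\<theta> ^ length (exits v xs) \<le> \<theta> + (1 - \<theta>) * 0 ^ length (exits v xs)"
    proof (cases "length (exits v xs)")
      case (Suc j)
      have "\<theta> * \<theta> ^ j \<le> \<theta> * 1" using assms by (intro mult_left_mono power_le_one) auto
      then show ?thesis using Suc by simp
    qed simp
  qed
  also have "\<dots> = \<theta> + (1 - \<theta>) * laplace v 0 L x"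
    unfolding laplace_def by (subst Bochner_Integration.integral_add) (auto intro: int)
  finally show ?thesis by (simp add: algebra_simps)
qed

lemma laplace_le_1: "x \<in> V \<Longrightarrow> 0 \<le> \<theta> \<Longrightarrow> \<theta> \<le> 1 \<Longrightarrow> laplace v \<theta> L x \<le> 1"
proof -
  assume a: "x \<in> V" "0 \<le> \<theta>" "\<theta> \<le> 1"
  have "laplace v \<theta> L x \<le> measure_pmf.expectation (lazy_walk E x L) (\<lambda>xs. 1)"
    unfolding laplace_def using a by (intro expectation_mono) (auto intro: power_le_one)
  then show ?thesis by simp
qed

lemma laplace_power:
  assumes "0 \<le> \<theta>" "\<theta> \<le> 1" "\<And>x. x \<in> V \<Longrightarrow> laplace v \<theta> s x \<le> M" "x \<in> V"
  shows "laplace v \<theta> (j * s) x \<le> M ^ j"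
  using assms(4)
proof (induction j arbitrary: x)
  case (Suc j)
  have M0: "0 \<le> M" using assms(3)[OF Suc.prems] laplace_nonneg[OF assms(1), of v s x] by linarith
  have "laplace v \<theta> (s + j * s) x \<le> M ^ j * laplace v \<theta> s x"
    by (rule laplace_submult) (use assms Suc in auto)
  also have "\<dots> \<le> M ^ j * M"
    using assms(3)[OF Suc.prems] M0 by (intro mult_left_mono) auto
  finally show ?case by (simp add: mult.commute)
qed (simp add: laplace_0)

text \<open>The division by 2 accounts for laziness: a visit to \<open>v\<close> is followed by a step leaving \<open>v\<close>
  with probability \<open>1/2\<close>.\<close>

definition expected_exits :: "nat \<Rightarrow> nat \<Rightarrow> nat \<Rightarrow> real" where
  "expected_exits v s x = (\<Sum>t<s. (P ^^ t) (\<lambda>y. of_bool (y = v)) x) / 2"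

lemma expected_exits_Suc:
  "expected_exits v (Suc s) x = of_bool (x = v) / 2 + P (expected_exits v s) x"
proof -
  have "P (expected_exits v s) x = P (\<lambda>x. 1 / 2 * (\<Sum>t<s. (P ^^ t) (\<lambda>y. of_bool (y = v)) x)) x"
    by (simp add: expected_exits_def[abs_def])
  also have "\<dots> = (\<Sum>t<s. (P ^^ Suc t) (\<lambda>y. of_bool (y = v)) x) / 2"
    by (subst lazy_op_cmult, subst lazy_op_sum) simp
  finally show ?thesis
    by (simp add: expected_exits_def sum.lessThan_Suc_shift add_divide_distrib del: sum.lessThan_Suc)
qed

lemma expected_exits_mono:
  assumes "x \<in> V" "s \<le> s'"
  shows "expected_exits v s x \<le> expected_exits v s' x"
proof -
  have "(P ^^ t) (\<lambda>y. of_bool (y = v)) x \<ge> 0" if "x \<in> V" for t x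
    using that
  proof (induction t arbitrary: x)
    case (Suc t)
    then show ?case using lazy_op_mono[OF Suc.prems, of "\<lambda>_. 0"] lazy_op_const[OF Suc.prems] by simp
  qed simp
  then show ?thesis unfolding expected_exits_def using assms
    by (intro divide_right_mono sum_mono2) auto
qed

text \<open>After its first departure from \<open>v\<close> the walk is at a neighbour of \<open>v\<close>, from where it leaves \<open>v\<close>
  at most \<open>R - 1\<close> more times in expectation.\<close>

lemma expected_exits_le_hit:
  assumes "x \<in> V" "v \<in> V" "s \<le> s'" "R \<ge> 1"
    and R: "\<And>u. u \<in> N v \<Longrightarrow> expected_exits v s' u \<le> R - 1"
  shows "expected_exits v s x \<le> R * (1 - laplace v 0 s x)"
  using assms(1,3)
\<comment> \<open>\<open>expected_exits\<close> is given by powers of the operator, so no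
  expectation over walks is needed here: both sides obey first-step recursions. The bound at
  neighbours is assumed at the fixed horizon \<open>s'\<close> and passes to shorter times by
  monotonicity.\<close>
proof (induction s arbitrary: x)
  case (Suc s)
  have IH: "expected_exits v s x \<le> R * (1 - laplace v 0 s x)" if "x \<in> V" for x
    using Suc that by simp
  show ?case
  proof (cases "x = v")
    case False
    have "P (expected_exits v s) x \<le> P (\<lambda>u. R * (1 - laplace v 0 s u)) x"
      by (rule lazy_op_mono[OF Suc.prems(1) IH])
    also have "\<dots> = R * (1 - laplace v 0 (Suc s) x)"
      using False by (simp add: lazy_op_cmult lazy_op_diff lazy_op_const[OF Suc.prems(1)] laplace_Suc[OF Suc.prems(1)])
    finally show ?thesis using False by (simp add: expected_exits_Suc)
  next
    case True
    have deg: "real (deg E v) > 0" using deg_pos[OF assms(2)] by simp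
    have "(\<Sum>u\<in>N v. expected_exits v s u) \<le> (\<Sum>u\<in>N v. R - 1)"
    proof (rule sum_mono)
      fix u assume u: "u \<in> N v"
      then have "u \<in> V" using nbrs_subset by blast
      then show "expected_exits v s u \<le> R - 1"
        using expected_exits_mono[of u s s' v] Suc.prems R[OF u] by simp
    qed
    also have "\<dots> = real (deg E v) * (R - 1)" by (simp add: deg_def)
    finally have out: "(\<Sum>u\<in>N v. expected_exits v s u) / (2 * real (deg E v)) \<le> (R - 1) / 2"
      using deg by (simp add: field_simps)
    have here: "expected_exits v s v \<le> R * (1 - laplace v 0 s v)" using IH assms(2) by simp
    have "(\<Sum>u\<in>N v. (if u \<noteq> v then 0 else 1) * laplace v 0 s u) = 0"
      by (intro sum.neutral) auto
    then have lap: "laplace v 0 (Suc s) v = laplace v 0 s v / 2"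
      by (simp add: laplace_Suc[OF assms(2)] lazy_op_def)
    \<comment> \<open>With probability 1/2 the walk departs now, which counts 1 plus at most
      \<open>R - 1\<close> later departures. Otherwise it stays, and the induction hypothesis at
      \<open>v\<close> applies.\<close>
    have gen: "1 / 2 + (a / 2 + b) \<le> R * (1 - l / 2)" if "b \<le> (R - 1) / 2" "a \<le> R * (1 - l)" for a b l
      using that by (simp add: field_simps)
    have "expected_exits v (Suc s) v
        = 1 / 2 + (expected_exits v s v / 2 + (\<Sum>u\<in>N v. expected_exits v s u) / (2 * real (deg E v)))"
      by (simp add: expected_exits_Suc lazy_op_def)
    then show ?thesis using gen[OF out here] by (simp only: True lap)
  qed
qed (simp add: expected_exits_def laplace_0)

text \<open>Every arrival at \<open>v\<close> uses an edge that is chosen with probability at most the inverse of the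
  minimum degree. Over a mixing time of order \<open>ln n\<close> this makes returns to \<open>v\<close> negligible, since
  \<open>d = \<alpha> ln n\<close> with \<open>\<alpha>\<close> of order \<open>1/\<epsilon>\<^sup>2\<close>.\<close>

lemma return_prob_le:
  assumes "u \<in> V" "v \<in> V" "u \<noteq> v"
  shows "(P ^^ t) (\<lambda>y. of_bool (y = v)) u \<le> 6 / (5 * d)"
proof -
  let ?f = "\<lambda>t. (P ^^ t) (\<lambda>y. of_bool (y = v))"
  \<comment> \<open>The fixed point of this recursion is 6/(5d), and it starts at 0 because
    \<open>u\<close> differs from \<open>v\<close>. The constant term is half the largest
    probability of using one given edge.\<close>
  have step: "?f (Suc t) x \<le> 1 / 2 * ?f t x + 3 / (5 * d)" if "x \<in> V" for t x
    using that
  proof (induction t arbitrary: x)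
    case 0
    have "(\<Sum>u\<in>N x. of_bool (u = v)) \<le> (1::real)"
      by (cases "v \<in> N x") (auto simp: of_bool_def)
    then have "(\<Sum>u\<in>N x. of_bool (u = v)) / (2 * real (deg E x)) \<le> 1 / (2 * real (deg E x))"
      by (intro divide_right_mono) auto
    also have "\<dots> \<le> 3 / (5 * d)" using inv_deg_le[OF 0] by simp
    finally show ?case by (simp add: lazy_op_def)
  next
    case (Suc t)
    have "?f (Suc (Suc t)) x \<le> P (\<lambda>x. 1 / 2 * ?f t x + 3 / (5 * d)) x"
      using lazy_op_mono[OF Suc.prems Suc.IH] by simp
    also have "\<dots> = 1 / 2 * ?f (Suc t) x + 3 / (5 * d)"
      by (simp only: lazy_op_add lazy_op_cmult lazy_op_const[OF Suc.prems] funpow.simps o_apply)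
    finally show ?case .
  qed
  show ?thesis
  proof (induction t)
    case (Suc t)
    then show ?case using step[OF assms(1), of t] by (simp add: field_simps)
  qed (use assms d_pos in auto)
qed

end

context expander
begin

lemma stationary_le: "v \<in> V \<Longrightarrow> real (deg E v) / total \<le> 8 / (5 * real n)"
proof -
  assume v: "v \<in> V"
  have "real n * (5 / 6 * d) = (\<Sum>x\<in>V. 5 / 6 * d)" by simp
  also have "\<dots> \<le> total" unfolding total_def by (intro sum_mono deg_lower)
  finally have t: "real n * (5 / 6 * d) \<le> total" .
  have "real (deg E v) * (5 * real n) \<le> 4 / 3 * d * (5 * real n)"
    by (intro mult_right_mono deg_upper[OF v]) auto
  also have "\<dots> \<le> 8 * total" using t by (simp add: algebra_simps)
  finally show ?thesis using total_pos n_pos by (simp add: divide_simps mult_ac)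
qed

text \<open>Split the time at \<open>T\<close>. Before it, use nonnegativity below and the return
  bound above; after it, every term is within \<eta> of the stationary mass.\<close>

lemma expected_exits_bounds:
  assumes "v \<in> V" "T \<le> s" and \<eta>: "2 * sqrt ((1 - 9 / 1024) ^ T) \<le> \<eta>"
  shows "x \<in> V \<Longrightarrow> real (s - T) * (real (deg E v) / total - \<eta>) / 2 \<le> expected_exits v s x" (is "_ \<Longrightarrow> ?thesis1")
    and "u \<in> N v \<Longrightarrow>
      expected_exits v s u \<le> (real T * (6 / (5 * d)) + real s * (8 / (5 * real n) + \<eta>)) / 2" (is "_ \<Longrightarrow> ?thesis2")
proof -
  let ?f = "\<lambda>t. (P ^^ t) (\<lambda>y. of_bool (y = v))"
  have near: "\<bar>?f t x - real (deg E v) / total\<bar> \<le> \<eta>" if "x \<in> V" "T \<le> t" for x t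
  proof -
    have "2 * sqrt ((1 - 9 / 1024) ^ t) \<le> 2 * sqrt ((1 - 9 / 1024 :: real) ^ T)"
      using that by (intro mult_left_mono real_sqrt_le_mono power_decreasing) auto
    then show ?thesis using mixing[OF that(1) assms(1), of t] \<eta> by linarith
  qed
  have f0: "?f t x \<ge> 0" if "x \<in> V" for t x
    using that
  proof (induction t arbitrary: x)
    case (Suc t)
    then show ?case using lazy_op_mono[OF Suc.prems, of "\<lambda>_. 0"] lazy_op_const[OF Suc.prems] by simp
  qed simp
  have split: "(\<Sum>t<s. ?f t x) = (\<Sum>t<T. ?f t x) + (\<Sum>t=T..<s. ?f t x)" for x
    using sum.atLeastLessThan_concat[of 0 T s "\<lambda>t. ?f t x"] assms(2) by (simp add: lessThan_atLeast0)
  show ?thesis1 if x: "x \<in> V"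
  proof -
    have "real (s - T) * (real (deg E v) / total - \<eta>) = (\<Sum>t=T..<s. real (deg E v) / total - \<eta>)"
      by simp
    also have "\<dots> \<le> (\<Sum>t=T..<s. ?f t x)"
    proof (rule sum_mono)
      fix t assume "t \<in> {T..<s}"
      then show "real (deg E v) / total - \<eta> \<le> ?f t x" using near[OF x, of t] by simp
    qed
    also have "\<dots> \<le> (\<Sum>t<s. ?f t x)" unfolding split using f0[OF x] by (simp add: sum_nonneg)
    finally show ?thesis by (simp add: expected_exits_def)
  qed
  show ?thesis2 if u: "u \<in> N v"
  proof -
    have uV: "u \<in> V" "u \<noteq> v" using u subsetD[OF nbrs_subset u] by auto
    have "(\<Sum>t<T. ?f t u) \<le> (\<Sum>t<T. 6 / (5 * d))"
      using return_prob_le[OF uV(1) assms(1) uV(2)] by (intro sum_mono)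
    moreover have "(\<Sum>t=T..<s. ?f t u) \<le> (\<Sum>t=T..<s. 8 / (5 * real n) + \<eta>)"
    proof (rule sum_mono)
      fix t assume "t \<in> {T..<s}"
      then show "?f t u \<le> 8 / (5 * real n) + \<eta>"
        using near[OF uV(1), of t] stationary_le[OF assms(1)] by simp
    qed
    moreover have "(\<Sum>t=T..<s. 8 / (5 * real n) + \<eta>) \<le> real s * (8 / (5 * real n) + \<eta>)"
    proof -
      have "0 \<le> 2 * sqrt ((1 - 9 / 1024 :: real) ^ T)" by simp
      then have "0 \<le> \<eta>" using \<eta> by linarith
      then show ?thesis by (simp add: mult_right_mono)
    qed
    ultimately show ?thesis unfolding expected_exits_def split by simp
  qed
qed

text \<open>\<open>p\<close> bounds from below the probability of leaving \<open>v\<close> within a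
  block of length \<open>s\<close>, uniformly in the starting point: first moment divided by the
  conditional first moment. Each block multiplies the generating function by at most exp(-(1 -
  \<theta>) p), and Markov's inequality for \<theta>^(number of departures) gives the tail.\<close>

lemma few_exits_prob:
  assumes "v \<in> V" "x \<in> V" "T \<le> s" "0 < s"
    and \<eta>: "2 * sqrt ((1 - 9 / 1024) ^ T) \<le> \<eta>"
    and \<pi>: "\<pi> \<le> real (deg E v) / total"
    and p: "p = (real (s - T) * (\<pi> - \<eta>) / 2) /
       (1 + (real T * (6 / (5 * d)) + real s * (8 / (5 * real n) + \<eta>)) / 2)"
    and \<theta>: "0 < \<theta>" "\<theta> < 1"
  shows "\<theta> ^ k * measure_pmf.prob (lazy_walk E x L) {xs. length (exits v xs) < k}
    \<le> exp (- ((1 - \<theta>) * p * real (L div s)))"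
proof -
  define R where "R = 1 + (real T * (6 / (5 * d)) + real s * (8 / (5 * real n) + \<eta>)) / 2"
  have "0 \<le> 2 * sqrt ((1 - 9 / 1024 :: real) ^ T)" by simp
  then have "0 \<le> \<eta>" using \<eta> by linarith
  then have R1: "R \<ge> 1" using d_pos unfolding R_def by simp
  have hit: "p \<le> 1 - laplace v 0 s y" if y: "y \<in> V" for y
  proof -
    have "real (s - T) * (\<pi> - \<eta>) / 2 \<le> real (s - T) * (real (deg E v) / total - \<eta>) / 2"
      using \<pi> by (intro divide_right_mono mult_left_mono) auto
    also have "\<dots> \<le> expected_exits v s y"
      by (rule expected_exits_bounds(1)[OF assms(1,3) \<eta> y])
    also have "\<dots> \<le> R * (1 - laplace v 0 s y)"
      using expected_exits_bounds(2)[OF assms(1,3) \<eta>] R1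
      by (intro expected_exits_le_hit[OF y assms(1) order.refl]) (auto simp: R_def)
    finally show ?thesis unfolding p R_def[symmetric] using R1 by (simp add: field_simps)
  qed
  have chunk: "laplace v \<theta> s y \<le> exp (- ((1 - \<theta>) * p))" if y: "y \<in> V" for y
  proof -
    have "laplace v \<theta> s y \<le> 1 - (1 - \<theta>) * (1 - laplace v 0 s y)"
      using laplace_le_avoid[OF y] \<theta> by simp
    also have "\<dots> \<le> 1 - (1 - \<theta>) * p" using hit[OF y] \<theta> by (simp add: mult_left_mono)
    also have "\<dots> \<le> exp (- ((1 - \<theta>) * p))" using exp_ge_add_one_self[of "- ((1 - \<theta>) * p)"] by simp
    finally show ?thesis .
  qed
  \<comment> \<open>The incomplete block is placed at the start, where its factor is at most 1; the
    blocks after it may start anywhere.\<close>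
  have "laplace v \<theta> (L mod s + L div s * s) x \<le> exp (- ((1 - \<theta>) * p)) ^ (L div s) * laplace v \<theta> (L mod s) x"
    using laplace_power[OF _ _ chunk] \<theta> assms(2) by (intro laplace_submult) auto
  also have "\<dots> \<le> exp (- ((1 - \<theta>) * p)) ^ (L div s) * 1"
    using \<theta> assms(2) by (intro mult_left_mono laplace_le_1) auto
  finally have main: "laplace v \<theta> L x \<le> exp (- ((1 - \<theta>) * p * real (L div s)))"
    by (simp add: exp_of_nat2_mult[symmetric])
  have "\<theta> ^ k * measure_pmf.prob (lazy_walk E x L) {xs. length (exits v xs) < k}
     = measure_pmf.expectation (lazy_walk E x L) (\<lambda>xs. \<theta> ^ k * indicator {xs. length (exits v xs) < k} xs)"
    by simp
  also have "\<dots> \<le> laplace v \<theta> L x"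
    unfolding laplace_def using \<theta> assms(2)
    by (intro expectation_mono) (auto simp: indicator_def intro!: power_decreasing)
  finally show ?thesis using main by linarith
qed

end

section \<open>Exponential supermartingales for the endpoints of departures\<close>

text \<open>A departure from v to u contributes the factor \<open>g v u\<close>. Truncation after
  \<open>k v\<close> departures fixes the number of factors once enough departures have occurred;
  the budget varies with \<open>v\<close> so that a first step can lower it at one vertex.\<close>

definition exit_weight :: "(nat \<Rightarrow> nat \<Rightarrow> real) \<Rightarrow> nat set \<Rightarrow> (nat \<Rightarrow> nat) \<Rightarrow> nat list \<Rightarrow> real" where
  "exit_weight g A k xs = (\<Prod>v\<in>A. prod_list (map (g v) (take (k v) (exits v xs))))"

lemma exit_weight_stay: "exit_weight g A k (x # x # ys) = exit_weight g A k (x # ys)"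
  by (simp add: exit_weight_def)

lemma exit_weight_skip:
  assumes "x \<notin> A \<or> k x = 0"
  shows "exit_weight g A k (x # u # ys) = exit_weight g A k (u # ys)"
  unfolding exit_weight_def using assms by (intro prod.cong) auto

lemma exit_weight_move:
  assumes "finite A" "x \<in> A" "k x > 0" "u \<noteq> x"
  shows "exit_weight g A k (x # u # ys) = g x u * exit_weight g A (k(x := k x - 1)) (u # ys)"
proof -
  let ?h = "\<lambda>k v xs. prod_list (map (g v) (take (k v) (exits v xs)))"
  have rest: "(\<Prod>v\<in>A - {x}. ?h k v (x # u # ys)) = (\<Prod>v\<in>A - {x}. ?h (k(x := k x - 1)) v (u # ys))"
    by (rule prod.cong) auto
  have "?h k x (x # u # ys) = g x u * ?h (k(x := k x - 1)) x (u # ys)"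
    using assms by (cases "k x") auto
  then show ?thesis unfolding exit_weight_def
    by (simp add: prod.remove[OF assms(1,2)] rest mult.assoc del: exits.simps)
qed

lemma prod_list_map_if_power:
  "prod_list (map (\<lambda>u. (if u \<in> S then a else b) * c) us)
    = a ^ length (filter (\<lambda>u. u \<in> S) us) * b ^ length (filter (\<lambda>u. u \<notin> S) us) * (c::real) ^ length us"
  by (induction us) auto

context near_regular
begin

text \<open>Conditionally on the past, the endpoint of a step leaving \<open>v\<close> is uniform on the neighbours of
  \<open>v\<close>, so the weight is a supermartingale.\<close>

lemma expectation_exit_weight:
  assumes "finite A"
    and "\<And>v u. 0 \<le> g v u"
    and avg: "\<And>v. v \<in> A \<Longrightarrow> v \<in> V \<Longrightarrow> (\<Sum>u\<in>N v. g v u) \<le> real (deg E v)"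
    and "x \<in> V"
  shows "measure_pmf.expectation (lazy_walk E x L) (exit_weight g A k) \<le> 1"
  using assms(4)
proof (induction L arbitrary: x k)
  case 0
  then show ?case by (simp add: exit_weight_def)
next
  case (Suc L)
  let ?e = "\<lambda>u. measure_pmf.expectation (lazy_walk E u L) (\<lambda>xs. exit_weight g A k (x # xs))"
  have "?e x = measure_pmf.expectation (lazy_walk E x L) (exit_weight g A k)"
    by (rule expectation_cong) (auto dest!: set_lazy_walk_Cons simp: exit_weight_stay)
  then have stay: "?e x \<le> 1" using Suc by simp
  have move: "(\<Sum>u\<in>N x. ?e u) \<le> real (deg E x)"
  proof (cases "x \<in> A \<and> k x > 0")
    case True
    have "?e u \<le> g x u" if "u \<in> N x" for u
    proof -
      have u: "u \<in> V" "u \<noteq> x" using that subsetD[OF nbrs_subset that] by auto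
      have "?e u = measure_pmf.expectation (lazy_walk E u L) (\<lambda>xs. g x u * exit_weight g A (k(x := k x - 1)) xs)"
        using True u assms(1)
        by (intro expectation_cong) (auto dest!: set_lazy_walk_Cons simp: exit_weight_move simp del: fun_upd_apply)
      also have "\<dots> = g x u * measure_pmf.expectation (lazy_walk E u L) (exit_weight g A (k(x := k x - 1)))"
        by simp
      also have "\<dots> \<le> g x u * 1" using Suc.IH[OF u(1)] assms(2) by (intro mult_left_mono) auto
      finally show ?thesis by simp
    qed
    then have "(\<Sum>u\<in>N x. ?e u) \<le> (\<Sum>u\<in>N x. g x u)" by (rule sum_mono)
    also have "\<dots> \<le> real (deg E x)" using avg True Suc.prems by blast
    finally show ?thesis .
  next
    case False
    have "?e u \<le> 1" if "u \<in> N x" for u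
    proof -
      have u: "u \<in> V" "u \<noteq> x" using that subsetD[OF nbrs_subset that] by auto
      have "?e u = measure_pmf.expectation (lazy_walk E u L) (exit_weight g A k)"
        using False
        by (intro expectation_cong) (auto dest!: set_lazy_walk_Cons simp: exit_weight_skip)
      then show ?thesis using Suc.IH[OF u(1)] by simp
    qed
    then have "(\<Sum>u\<in>N x. ?e u) \<le> (\<Sum>u\<in>N x. 1)" by (rule sum_mono)
    then show ?thesis by (simp add: deg_def)
  qed
  have deg: "real (deg E x) > 0" using deg_pos[OF Suc.prems] by simp
  have "measure_pmf.expectation (lazy_walk E x (Suc L)) (exit_weight g A k) = P ?e x"
    by (rule expectation_lazy_walk_Suc[OF Suc.prems])
  also have "\<dots> = ?e x / 2 + (\<Sum>u\<in>N x. ?e u) / (2 * real (deg E x))" by (simp only: lazy_op_def)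
  also have "\<dots> \<le> 1 / 2 + real (deg E x) / (2 * real (deg E x))"
    using stay move deg by (intro add_mono divide_right_mono) auto
  finally show ?case using deg by simp
qed

lemma prob_exit_weight:
  assumes "finite A" "\<And>v u. 0 \<le> g v u"
    and "\<And>v. v \<in> A \<Longrightarrow> v \<in> V \<Longrightarrow> (\<Sum>u\<in>N v. g v u) \<le> real (deg E v)"
    and "x \<in> V" "C > 0"
    and S: "\<And>xs. xs \<in> S \<Longrightarrow> C \<le> exit_weight g A k xs"
  shows "measure_pmf.prob (lazy_walk E x L) S \<le> 1 / C"
proof -
  have nonneg: "exit_weight g A k xs \<ge> 0" for xs
    unfolding exit_weight_def using assms(2) by (intro prod_nonneg ballI prod_list_nonneg) auto
  have "C * measure_pmf.prob (lazy_walk E x L) S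
     = measure_pmf.expectation (lazy_walk E x L) (\<lambda>xs. C * indicator S xs)" by simp
  also have "\<dots> \<le> measure_pmf.expectation (lazy_walk E x L) (exit_weight g A k)"
    using S nonneg assms(4) by (intro expectation_mono) (auto simp: indicator_def)
  also have "\<dots> \<le> 1" by (rule expectation_exit_weight) (use assms in auto)
  finally show ?thesis using assms(5) by (simp add: field_simps)
qed

text \<open>Reward each departure landing in \<open>S\<close> by 1 + 1/q and normalise by exp(-b/q),
  with b the chance of landing there; the average is at most 1 since 1 + y <= exp y. As the b sum to
  at most q |A|, normalising costs at most a factor e per departure, while the event earns q^(-1)
  for half of them.\<close>

lemma prob_half_exits_in:
  assumes A: "A \<subseteq> V" and "x \<in> V" and q: "q > 0"
    and le: "(\<Sum>v\<in>A. real (card (N v \<inter> S)) / real (deg E v)) \<le> q * real (card A)"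
  shows "measure_pmf.prob (lazy_walk E x L)
      {xs. (\<forall>v\<in>A. k \<le> length (exits v xs)) \<and>
           card A * k \<le> 2 * (\<Sum>v\<in>A. length (filter (\<lambda>u. u \<in> S) (take k (exits v xs))))}
    \<le> exp (real (card A * k)) * q powr (real (card A * k) / 2)"
proof -
  define b where "b = (\<lambda>v. real (card (N v \<inter> S)) / real (deg E v))"
  define g where "g = (\<lambda>v u. (if u \<in> S then 1 + 1 / q else 1) * exp (- b v / q))"
  have finA: "finite A" using A finite_subset by blast
  have "measure_pmf.prob (lazy_walk E x L)
      {xs. (\<forall>v\<in>A. k \<le> length (exits v xs)) \<and>
           card A * k \<le> 2 * (\<Sum>v\<in>A. length (filter (\<lambda>u. u \<in> S) (take k (exits v xs))))}
    \<le> 1 / ((1 / q) powr (real (card A * k) / 2) * exp (- real (card A * k)))"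
  proof (rule prob_exit_weight[OF finA, of g])
    show "0 \<le> g v u" for v u using q by (simp add: g_def)
    show "x \<in> V" by fact
    show "(1 / q) powr (real (card A * k) / 2) * exp (- real (card A * k)) > 0"
      using q by simp
  next
    fix v assume v: "v \<in> V"
    have d: "real (deg E v) > 0" using deg_pos[OF v] by simp
    have "(\<Sum>u\<in>N v. g v u) = (\<Sum>u\<in>N v. (if u \<in> S then 1 + 1 / q else 1)) * exp (- b v / q)"
      by (simp add: g_def sum_distrib_right)
    also have "(\<Sum>u\<in>N v. (if u \<in> S then 1 + 1 / q else 1)) = (\<Sum>u\<in>N v. 1 + (if u \<in> S then 1 / q else 0))"
      by (intro sum.cong) auto
    also have "\<dots> = real (deg E v) + (\<Sum>u\<in>N v \<inter> S. 1 / q)"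
      by (subst sum.distrib, subst sum.inter_restrict) (simp_all add: deg_def)
    also have "\<dots> = real (deg E v) * (1 + b v / q)"
      using d by (simp add: b_def field_simps)
    also have "\<dots> * exp (- b v / q) \<le> real (deg E v) * exp (b v / q) * exp (- b v / q)"
      by (intro mult_right_mono mult_left_mono exp_ge_add_one_self) auto
    also have "\<dots> = real (deg E v)" by (simp add: exp_minus)
    finally show "(\<Sum>u\<in>N v. g v u) \<le> real (deg E v)" .
  next
    fix xs
    assume "xs \<in> {xs. (\<forall>v\<in>A. k \<le> length (exits v xs)) \<and>
           card A * k \<le> 2 * (\<Sum>v\<in>A. length (filter (\<lambda>u. u \<in> S) (take k (exits v xs))))}"
    then have len: "\<And>v. v \<in> A \<Longrightarrow> k \<le> length (exits v xs)"
      and half: "card A * k \<le> 2 * (\<Sum>v\<in>A. length (filter (\<lambda>u. u \<in> S) (take k (exits v xs))))" by auto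
    let ?j = "\<Sum>v\<in>A. length (filter (\<lambda>u. u \<in> S) (take k (exits v xs)))"
    have "exit_weight g A (\<lambda>_. k) xs
      = (\<Prod>v\<in>A. (1 + 1 / q) ^ length (filter (\<lambda>u. u \<in> S) (take k (exits v xs))) * exp (- b v / q) ^ k)"
      unfolding exit_weight_def g_def by (intro prod.cong refl) (simp add: prod_list_map_if_power len min_absorb2)
    also have "\<dots> = (1 + 1 / q) ^ ?j * exp (- (\<Sum>v\<in>A. b v) * real k / q)"
    proof -
      have "(\<Prod>v\<in>A. exp (- b v / q) ^ k) = exp (\<Sum>v\<in>A. real k * (- b v / q))"
        by (simp only: exp_sum[OF finA] exp_of_nat_mult)
      also have "(\<Sum>v\<in>A. real k * (- b v / q)) = (\<Sum>v\<in>A. b v) * (- real k / q)"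
        unfolding sum_distrib_right by (intro sum.cong) auto
      finally show ?thesis by (simp add: prod.distrib power_sum)
    qed
    also have "\<dots> \<ge> (1 / q) powr (real (card A * k) / 2) * exp (- real (card A * k))"
    proof (rule mult_mono)
      have "(1 / q) powr (real (card A * k) / 2) \<le> (1 + 1 / q) powr (real (card A * k) / 2)"
        using q by (intro powr_mono2) auto
      also have "\<dots> \<le> (1 + 1 / q) powr real ?j"
        using half q by (intro powr_mono) (auto simp flip: of_nat_sum of_nat_mult)
      also have "\<dots> = (1 + 1 / q) ^ ?j" using q by (subst powr_realpow) (auto intro: add_pos_pos)
      finally show "(1 / q) powr (real (card A * k) / 2) \<le> (1 + 1 / q) ^ ?j" .
      have "(\<Sum>v\<in>A. b v) * real k \<le> q * real (card A) * real k"
        using le unfolding b_def by (intro mult_right_mono) auto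
      then show "exp (- real (card A * k)) \<le> exp (- (\<Sum>v\<in>A. b v) * real k / q)"
        using q by (simp add: field_simps)
    qed (use q in auto)
    finally show "(1 / q) powr (real (card A * k) / 2) * exp (- real (card A * k)) \<le> exit_weight g A (\<lambda>_. k) xs" .
  qed
  also have "\<dots> = exp (real (card A * k)) * q powr (real (card A * k) / 2)"
    using q by (simp add: powr_divide exp_minus field_simps)
  finally show ?thesis .
qed

text \<open>Weight 0 on \<open>S\<close> and exp l off it averages to at most (1 - l) exp l <=
  1.\<close>

lemma prob_exits_avoid:
  assumes A: "A \<subseteq> V" and "x \<in> V"
    and le: "\<And>v. v \<in> A \<Longrightarrow> l * real (deg E v) \<le> real (card (N v \<inter> S))"
  shows "measure_pmf.prob (lazy_walk E x L)
      {xs. \<forall>v\<in>A. k \<le> length (exits v xs) \<and> set (exits v xs) \<inter> S = {}}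
    \<le> exp (- (l * real k * real (card A)))"
proof -
  define g where "g = (\<lambda>(v::nat) u. (if u \<in> S then 0 else 1) * exp l)"
  have finA: "finite A" using A finite_subset by blast
  have "measure_pmf.prob (lazy_walk E x L)
      {xs. \<forall>v\<in>A. k \<le> length (exits v xs) \<and> set (exits v xs) \<inter> S = {}}
    \<le> 1 / exp (l * real k * real (card A))"
  proof (rule prob_exit_weight[OF finA, of g])
    show "0 \<le> g v u" for v u by (simp add: g_def)
    show "x \<in> V" by fact
    show "0 < exp (l * real k * real (card A))" by simp
  next
    fix v assume v: "v \<in> A" "v \<in> V"
    have "(\<Sum>u\<in>N v. g v u) = (\<Sum>u\<in>N v. 1 - (if u \<in> S then 1 else 0)) * exp l"
      unfolding g_def sum_distrib_right by (intro sum.cong) auto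
    also have "(\<Sum>u\<in>N v. 1 - (if u \<in> S then 1 else 0)) = real (deg E v) - real (card (N v \<inter> S))"
      by (subst sum_subtractf) (simp add: deg_def sum.inter_restrict[symmetric])
    also have "(real (deg E v) - real (card (N v \<inter> S))) * exp l \<le> real (deg E v) * (1 + - l) * exp l"
      using le[OF v(1)] by (intro mult_right_mono) (auto simp: algebra_simps)
    also have "\<dots> \<le> real (deg E v) * exp (- l) * exp l"
      by (intro mult_right_mono mult_left_mono exp_ge_add_one_self) auto
    also have "\<dots> = real (deg E v)" by (simp add: exp_minus)
    finally show "(\<Sum>u\<in>N v. g v u) \<le> real (deg E v)" .
  next
    fix xs assume "xs \<in> {xs. \<forall>v\<in>A. k \<le> length (exits v xs) \<and> set (exits v xs) \<inter> S = {}}"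
    then have xs: "k \<le> length (exits v xs)" "set (exits v xs) \<inter> S = {}" if "v \<in> A" for v
      using that by auto
    have "exit_weight g A (\<lambda>_. k) xs = (\<Prod>v\<in>A. exp l ^ k)"
      unfolding exit_weight_def
    proof (rule prod.cong[OF refl])
      fix v assume v: "v \<in> A"
      have no: "u \<notin> S" if "u \<in> set (take k (exits v xs))" for u
        using xs(2)[OF v] set_take_subset[of k "exits v xs"] that by blast
      have "map (g v) (take k (exits v xs)) = map (\<lambda>_. exp l) (take k (exits v xs))"
        by (rule map_cong[OF refl]) (simp add: g_def no)
      then show "prod_list (map (g v) (take k (exits v xs))) = exp l ^ k"
        using xs(1)[OF v] by (simp add: map_replicate_const prod_list_replicate min_absorb2)
    qed
    also have "\<dots> = exp (l * real k * real (card A))"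
      by (simp add: exp_of_nat_mult[symmetric] mult_ac flip: exp_of_nat2_mult)
    finally show "exp (l * real k * real (card A)) \<le> exit_weight g A (\<lambda>_. k) xs" by simp
  qed
  then show ?thesis by (simp add: exp_minus divide_inverse)
qed

end

section \<open>Neighbourhoods of small sets in the trace\<close>

lemma sum_Pow_power:
  fixes x :: real
  assumes "finite U"
  shows "(\<Sum>W\<in>Pow U. x ^ card W) = (1 + x) ^ card U"
  using prod_add[OF assms, of "\<lambda>_. x" "\<lambda>_. 1"] by (simp add: add.commute)

text \<open>Each set counted contributes at least x^m to the generating function (1 + x)^|U|. The
  free \<open>x\<close> is later the density m/\<open>host_size\<close>, or 1/ln n.\<close>

lemma card_small_subsets_le:
  fixes x m :: real
  assumes "finite U" "0 < x" "x \<le> 1"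
  shows "real (card {W. W \<subseteq> U \<and> real (card W) \<le> m}) \<le> exp (x * real (card U)) * x powr (- m)"
proof -
  have "x powr m * real (card {W. W \<subseteq> U \<and> real (card W) \<le> m})
      = (\<Sum>W | W \<subseteq> U \<and> real (card W) \<le> m. x powr m)" by simp
  also have "\<dots> \<le> (\<Sum>W | W \<subseteq> U \<and> real (card W) \<le> m. x ^ card W)"
  proof (rule sum_mono)
    fix W assume "W \<in> {W. W \<subseteq> U \<and> real (card W) \<le> m}"
    then have "x powr m \<le> x powr real (card W)" using assms by (intro powr_mono') auto
    then show "x powr m \<le> x ^ card W" using assms by (simp add: powr_realpow)
  qed
  also have "\<dots> \<le> (\<Sum>W\<in>Pow U. x ^ card W)"
    using assms by (intro sum_mono2) auto
  also have "\<dots> = (1 + x) ^ card U" by (rule sum_Pow_power[OF assms(1)])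
  also have "\<dots> \<le> exp x ^ card U"
    using assms by (intro power_mono exp_ge_add_one_self) auto
  also have "\<dots> = exp (x * real (card U))" by (simp add: exp_of_nat2_mult)
  finally show ?thesis using assms by (simp add: powr_minus field_simps)
qed

text \<open>The left-hand side counts every edge twice, hence the factor 4 for a cut with half of the edges.\<close>

lemma exists_half_cut:
  fixes c :: "'a \<Rightarrow> 'a \<Rightarrow> real"
  assumes "finite A" and sym: "\<And>x y. c x y = c y x" and "\<And>x. c x x = 0" and "\<And>x y. c x y \<ge> 0"
  shows "\<exists>B\<subseteq>A. (\<Sum>x\<in>A. \<Sum>y\<in>A. c x y) \<le> 4 * (\<Sum>x\<in>B. \<Sum>y\<in>A - B. c x y)"
  using assms(1)
proof (induction A)
  case (insert z A)
  then obtain B where B: "B \<subseteq> A" "(\<Sum>x\<in>A. \<Sum>y\<in>A. c x y) \<le> 4 * (\<Sum>x\<in>B. \<Sum>y\<in>A - B. c x y)" by blast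
  have fin: "finite A" "finite B" "finite (A - B)" using insert B finite_subset by auto
  have z: "z \<notin> A" "z \<notin> B" using insert B by auto
  define p where "p = (\<Sum>y\<in>B. c z y)"
  define q where "q = (\<Sum>y\<in>A - B. c z y)"
  have pq: "(\<Sum>y\<in>A. c z y) = p + q"
    unfolding p_def q_def using fin(1) B(1) by (simp add: sum.subset_diff add.commute)
  have "(\<Sum>x\<in>insert z A. \<Sum>y\<in>insert z A. c x y)
      = (\<Sum>y\<in>A. c z y) + (\<Sum>x\<in>A. c x z) + (\<Sum>x\<in>A. \<Sum>y\<in>A. c x y)"
    using fin z assms(3) by (simp add: sum.distrib)
  also have "(\<Sum>x\<in>A. c x z) = (\<Sum>y\<in>A. c z y)" by (rule sum.cong[OF refl sym])
  also have "(\<Sum>y\<in>A. c z y) + (\<Sum>y\<in>A. c z y) + (\<Sum>x\<in>A. \<Sum>y\<in>A. c x y)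
      \<le> 2 * (p + q) + 4 * (\<Sum>x\<in>B. \<Sum>y\<in>A - B. c x y)"
    unfolding pq by (rule add_mono[OF _ B(2)]) simp
  finally have total: "(\<Sum>x\<in>insert z A. \<Sum>y\<in>insert z A. c x y)
      \<le> 2 * (p + q) + 4 * (\<Sum>x\<in>B. \<Sum>y\<in>A - B. c x y)" .
  show ?case
  \<comment> \<open>Greedy choice: the new vertex joins the side to which it has less weight, so the
    cut gains at least (p + q)/2.\<close>
  proof (cases "p \<ge> q")
    case True
    have "insert z A - B = insert z (A - B)" using z by auto
    then have "(\<Sum>x\<in>B. \<Sum>y\<in>insert z A - B. c x y) = (\<Sum>x\<in>B. c x z) + (\<Sum>x\<in>B. \<Sum>y\<in>A - B. c x y)"
      using fin z by (simp add: sum.distrib)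
    also have "(\<Sum>x\<in>B. c x z) = p" unfolding p_def by (rule sum.cong[OF refl sym])
    finally show ?thesis using total True B(1) by (intro exI[of _ B]) auto
  next
    case False
    have "insert z A - insert z B = A - B" using z by auto
    then have "(\<Sum>x\<in>insert z B. \<Sum>y\<in>insert z A - insert z B. c x y) = q + (\<Sum>x\<in>B. \<Sum>y\<in>A - B. c x y)"
      using fin z by (simp add: q_def)
    then show ?thesis using total False B(1) by (intro exI[of _ "insert z B"]) auto
  qed
qed simp

context near_regular
begin

lemma sum_edge_ind_card: "finite S \<Longrightarrow> (\<Sum>y\<in>S. edge_ind x y) = real (card (N x \<inter> S))"
  by (simp add: edge_ind_def sum.inter_restrict[symmetric] Int_commute flip: sum.inter_filter)

lemma sum_card_nbrs_swap:
  assumes "finite A" "finite B"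
  shows "(\<Sum>x\<in>A. real (card (N x \<inter> B))) = (\<Sum>y\<in>B. real (card (N y \<inter> A)))"
proof -
  have "(\<Sum>x\<in>A. real (card (N x \<inter> B))) = (\<Sum>x\<in>A. \<Sum>y\<in>B. edge_ind x y)"
    using assms by (simp add: sum_edge_ind_card)
  also have "\<dots> = (\<Sum>y\<in>B. \<Sum>x\<in>A. edge_ind y x)" by (subst sum.swap) (simp add: edge_ind_sym)
  finally show ?thesis using assms by (simp add: sum_edge_ind_card)
qed

lemma card_edges_between_single:
  assumes "u \<notin> A" "finite A"
  shows "card (edges_between E {u} A) = card (N u \<inter> A)"
  using assms by (subst card_edges_between_disjoint) auto

end

section \<open>Edges from a small set to itself and to its heavy and light neighbours\<close>

locale sparse_graph = near_regular n E d for n E d +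
  fixes \<alpha> K0 :: real
  assumes d_def: "d = \<alpha> * ln (real n)"
    and \<alpha>_ge: "1 \<le> \<alpha>"
    and ln_ge: "1 \<le> ln (real n)"
    and P4: "P4 K0 \<alpha> n E"
begin

text \<open>A vertex outside \<open>A\<close> is heavy if it has at least \<open>K\<close> times the number of neighbours in \<open>A\<close>
  that it would have in a random graph, or at least \<open>K\<close> if that number is less than one.\<close>

definition thr :: "real \<Rightarrow> nat set \<Rightarrow> real" where
  "thr K A = (if real (card A) < real n / d then K else K * real (card A) * d / real n)"

definition heavy :: "real \<Rightarrow> nat set \<Rightarrow> nat set" where
  "heavy K A = {u \<in> ext_nbhd n E A. thr K A \<le> real (card (N u \<inter> A))}"

text \<open>Merges the two regimes of (P4): the saving \<open>K\<close> in the denser one is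
  weakened to \<open>ln K\<close>.\<close>

lemma heavy_edges:
  assumes A: "A \<subseteq> V" "A \<noteq> {}" "real (card A) \<le> real n / ln (real n)" and K: "K0 \<le> K" "1 < K"
  shows "(\<Sum>v\<in>A. real (card (N v \<inter> heavy K A))) \<le> real (card A) * d / ln K"
proof -
  have finA: "finite A" using A finite_subset by blast
  have finH: "finite (heavy K A)" by (simp add: heavy_def ext_nbhd_def)
  have disj: "A \<inter> heavy K A = {}" by (auto simp: heavy_def ext_nbhd_def)
  have "heavy K A = {u \<in> ext_nbhd n E A. thr K A \<le> real (card (edges_between E {u} A))}"
    unfolding heavy_def using finA by (auto simp: card_edges_between_single ext_nbhd_def)
  then have eq: "(\<Sum>v\<in>A. real (card (N v \<inter> heavy K A))) = real (card (edges_between E A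
       {u \<in> ext_nbhd n E A. thr K A \<le> real (card (edges_between E {u} A))}))"
    using card_edges_between_disjoint[OF finA finH disj] by simp
  have dd: "x * \<alpha> * ln (real n) = x * d" for x by (simp add: d_def)
  have P: "(real n / d \<le> real (card A) \<longrightarrow>
         real (card (edges_between E A {u \<in> ext_nbhd n E A.
             real (card (edges_between E {u} A)) \<ge> K * real (card A) * d / real n}))
           \<le> real (card A) * d / K) \<and>
      (real (card A) < real n / d \<longrightarrow>
         real (card (edges_between E A {u \<in> ext_nbhd n E A.
             real (card (edges_between E {u} A)) \<ge> K}))
           \<le> real (card A) * d / ln K)"
    using P4 A K unfolding P4_def Let_def dd d_def[symmetric] by blast
  show ?thesis
  proof (cases "real (card A) < real n / d")
    case True
    then show ?thesis using P unfolding eq by (simp add: thr_def)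
  next
    case False
    then have "(\<Sum>v\<in>A. real (card (N v \<inter> heavy K A))) \<le> real (card A) * d / K"
      using P unfolding eq by (simp add: thr_def)
    also have "\<dots> \<le> real (card A) * d / ln K"
      using K d_pos ln_bound[of K] by (intro divide_left_mono) auto
    finally show ?thesis .
  qed
qed

lemma thr_le:
  assumes "0 < K" "real (card A) \<le> real n / ln (real n)"
  shows "thr K A \<le> K * \<alpha>"
proof -
  have "real (card A) * d \<le> real n / ln (real n) * d"
    using assms d_pos by (intro mult_right_mono) auto
  also have "\<dots> = real n * \<alpha>" using ln_ge by (simp add: d_def)
  finally have "K * (real (card A) * d) \<le> K * (real n * \<alpha>)" using assms by (intro mult_left_mono) auto
  then show ?thesis using assms \<alpha>_ge n_pos unfolding thr_def by (simp add: field_simps)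
qed

text \<open>(P4) speaks only of external neighbours, so the edges inside \<open>A\<close> are first
  reduced to a cut between \<open>B\<close> and \<open>A - B\<close>. Vertices heavy for
  \<open>B\<close> are covered by (P4). All others have at most K \<alpha> neighbours in
  \<open>B\<close>, and \<open>K * ln K \<le> ln n\<close> turns this into d / ln K. The cut factor
  4 times these two shares gives 8.\<close>

lemma inner_edges:
  assumes A: "A \<subseteq> V" "real (card A) \<le> real n / ln (real n)"
    and K: "K0 \<le> K" "1 < K" "K * ln K \<le> ln (real n)"
  shows "(\<Sum>v\<in>A. real (card (N v \<inter> A))) \<le> 8 * (real (card A) * d / ln K)"
proof -
  have finA: "finite A" using A finite_subset by blast
  obtain B where B: "B \<subseteq> A" "(\<Sum>x\<in>A. \<Sum>y\<in>A. edge_ind x y) \<le> 4 * (\<Sum>x\<in>B. \<Sum>y\<in>A - B. edge_ind x y)"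
  proof -
    have "edge_ind x x = 0" "edge_ind x y \<ge> 0" for x y by (auto simp: edge_ind_def)
    then show ?thesis using exists_half_cut[OF finA, of edge_ind] edge_ind_sym that by blast
  qed
  have finB: "finite B" using B finA finite_subset by blast
  have lnK: "ln K > 0" using K by simp
  have cut: "(\<Sum>x\<in>B. \<Sum>y\<in>A - B. edge_ind x y) \<le> 2 * (real (card A) * d / ln K)"
  proof (cases "B = {}")
    case True
    then show ?thesis using d_pos lnK by simp
  next
    case False
    have cardBA: "card B \<le> card A" using B finA by (intro card_mono)
    then have cB: "real (card B) \<le> real n / ln (real n)" using A by linarith
    have "(\<Sum>x\<in>B. \<Sum>y\<in>A - B. edge_ind x y) = (\<Sum>u\<in>A - B. real (card (N u \<inter> B)))"
      using finA finB by (simp add: sum_edge_ind_card sum_card_nbrs_swap)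
    also have "\<dots> \<le> (\<Sum>u\<in>A - B. (if u \<in> heavy K B then real (card (N u \<inter> B)) else 0) + K * \<alpha>)"
    proof (rule sum_mono)
      fix u assume u: "u \<in> A - B"
      have nn: "0 \<le> K * \<alpha>" using K \<alpha>_ge by simp
      show "real (card (N u \<inter> B)) \<le> (if u \<in> heavy K B then real (card (N u \<inter> B)) else 0) + K * \<alpha>"
      proof (cases "u \<in> heavy K B \<or> N u \<inter> B = {}")
        case False
        then have "u \<in> ext_nbhd n E B" using u A by (auto simp: ext_nbhd_def nbrs_def)
        then have "real (card (N u \<inter> B)) < thr K B" using False by (auto simp: heavy_def)
        also have "\<dots> \<le> K * \<alpha>" using thr_le[OF _ cB, of K] K by simp
        finally show ?thesis using False by simp
      qed (use nn in auto)
    qed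
    also have "\<dots> = (\<Sum>u\<in>(A - B) \<inter> heavy K B. real (card (N u \<inter> B))) + real (card (A - B)) * (K * \<alpha>)"
      using finA by (simp add: sum.distrib sum.inter_restrict)
    also have "\<dots> \<le> (\<Sum>u\<in>heavy K B. real (card (N u \<inter> B))) + real (card A) * (d / ln K)"
    proof (intro add_mono mult_mono)
      show "(\<Sum>u\<in>(A - B) \<inter> heavy K B. real (card (N u \<inter> B))) \<le> (\<Sum>u\<in>heavy K B. real (card (N u \<inter> B)))"
        by (rule sum_mono2) (auto simp: heavy_def ext_nbhd_def)
      have "\<alpha> * (K * ln K) \<le> \<alpha> * ln (real n)" using K \<alpha>_ge by (intro mult_left_mono) auto
      then show "K * \<alpha> \<le> d / ln K" using lnK by (simp add: d_def field_simps)
      show "real (card (A - B)) \<le> real (card A)" using finA by (simp add: card_mono)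
    qed (use K \<alpha>_ge in auto)
    also have "(\<Sum>u\<in>heavy K B. real (card (N u \<inter> B))) = (\<Sum>v\<in>B. real (card (N v \<inter> heavy K B)))"
      by (rule sum_card_nbrs_swap) (use finB in \<open>auto simp: heavy_def ext_nbhd_def\<close>)
    also have "\<dots> \<le> real (card B) * d / ln K"
      using A B False cB K by (intro heavy_edges) auto
    also have "\<dots> \<le> real (card A) * d / ln K"
      using cardBA d_pos lnK by (intro divide_right_mono mult_right_mono) auto
    finally show ?thesis by (simp add: mult.commute)
  qed
  then show ?thesis using B(2) finA by (simp add: sum_edge_ind_card)
qed

lemma sum_div_deg_le:
  assumes "A \<subseteq> V" "(\<Sum>v\<in>A. real (card (N v \<inter> S))) \<le> t"
  shows "(\<Sum>v\<in>A. real (card (N v \<inter> S)) / real (deg E v)) \<le> 6 / (5 * d) * t"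
proof -
  have "(\<Sum>v\<in>A. real (card (N v \<inter> S)) / real (deg E v)) \<le> (\<Sum>v\<in>A. 6 / (5 * d) * real (card (N v \<inter> S)))"
  proof (rule sum_mono)
    fix v assume "v \<in> A"
    then have "1 / real (deg E v) \<le> 6 / (5 * d)" using assms inv_deg_le[of v] by blast
    from mult_right_mono[OF this, of "real (card (N v \<inter> S))"]
    show "real (card (N v \<inter> S)) / real (deg E v) \<le> 6 / (5 * d) * real (card (N v \<inter> S))" by simp
  qed
  also have "\<dots> \<le> 6 / (5 * d) * t"
    unfolding sum_distrib_left[symmetric] using assms d_pos by (intro mult_left_mono) auto
  finally show ?thesis .
qed

definition light :: "real \<Rightarrow> nat set \<Rightarrow> nat set" where
  "light K A = ext_nbhd n E A - heavy K A"

text \<open>Steps from \<open>A\<close> missing the light set land in \<open>A\<close> or at heavy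
  vertices: 8 + 1 shares of |A| d / ln K, times 6/(5d) from the minimum degree.\<close>

lemma not_light_fraction:
  assumes A: "A \<subseteq> V" "A \<noteq> {}" "real (card A) \<le> real n / ln (real n)"
    and K: "K0 \<le> K" "1 < K" "K * ln K \<le> ln (real n)"
  shows "(\<Sum>v\<in>A. real (card (N v \<inter> - light K A)) / real (deg E v)) \<le> 54 / (5 * ln K) * real (card A)"
proof -
  have "(\<Sum>v\<in>A. real (card (N v \<inter> - light K A)))
      \<le> (\<Sum>v\<in>A. real (card (N v \<inter> A)) + real (card (N v \<inter> heavy K A)))"
  proof (rule sum_mono)
    fix v assume v: "v \<in> A"
    have "N v \<inter> - light K A \<subseteq> (N v \<inter> A) \<union> (N v \<inter> heavy K A)"
    proof
      fix u assume u: "u \<in> N v \<inter> - light K A"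
      then have "u \<in> V" "{u, v} \<in> E" using subsetD[OF nbrs_subset] by (auto simp: nbrs_def insert_commute)
      then show "u \<in> (N v \<inter> A) \<union> (N v \<inter> heavy K A)" using u v by (auto simp: light_def ext_nbhd_def)
    qed
    then have "card (N v \<inter> - light K A) \<le> card ((N v \<inter> A) \<union> (N v \<inter> heavy K A))"
      by (intro card_mono) auto
    also have "\<dots> \<le> card (N v \<inter> A) + card (N v \<inter> heavy K A)" by (rule card_Un_le)
    finally show "real (card (N v \<inter> - light K A)) \<le> real (card (N v \<inter> A)) + real (card (N v \<inter> heavy K A))"
      by linarith
  qed
  also have "\<dots> \<le> 8 * (real (card A) * d / ln K) + real (card A) * d / ln K"
    unfolding sum.distrib by (intro add_mono inner_edges[OF A(1,3) K] heavy_edges[OF A K(1,2)])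
  also have "\<dots> = 9 * (real (card A) * d / ln K)" by simp
  finally have "(\<Sum>v\<in>A. real (card (N v \<inter> - light K A)) / real (deg E v))
      \<le> 6 / (5 * d) * (9 * (real (card A) * d / ln K))"
    by (rule sum_div_deg_le[OF A(1)])
  then show ?thesis using d_pos by simp
qed

text \<open>This is min(|A| d, n), up to a constant the room available for the neighbours of
  \<open>A\<close>. With it both cases of \<open>thr\<close> become \<open>K\<close> times the
  average number |A| d / \<open>host_size A\<close> of neighbours in \<open>A\<close>.\<close>

definition host_size :: "nat set \<Rightarrow> real" where
  "host_size A = (if real (card A) < real n / d then real (card A) * d else real n)"

lemma thr_eq:
  assumes "A \<subseteq> V" "A \<noteq> {}" "finite A"
  shows "thr K A = K * real (card A) * d / host_size A"
  using assms d_pos n_pos by (auto simp: thr_def host_size_def card_gt_0_iff)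

lemma card_light_le:
  assumes A: "A \<subseteq> V"
  shows "real (card (light K A)) \<le> 4 / 3 * host_size A"
proof (cases "real (card A) < real n / d")
  case True
  have finA: "finite A" using A finite_subset by blast
  have "light K A \<subseteq> (\<Union>v\<in>A. N v)" by (auto simp: light_def ext_nbhd_def nbrs_def insert_commute)
  then have "card (light K A) \<le> card (\<Union>v\<in>A. N v)" using finA by (intro card_mono) auto
  also have "\<dots> \<le> (\<Sum>v\<in>A. card (N v))" using finA by (rule card_UN_le)
  finally have "real (card (light K A)) \<le> (\<Sum>v\<in>A. real (deg E v))"
    by (simp add: deg_def flip: of_nat_sum)
  also have "\<dots> \<le> (\<Sum>v\<in>A. 4 / 3 * d)" using A by (intro sum_mono deg_upper) auto
  finally show ?thesis using True by (simp add: host_size_def)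
next
  case False
  have "card (light K A) \<le> card V" by (rule card_mono) (auto simp: light_def ext_nbhd_def)
  then show ?thesis using False by (simp add: host_size_def)
qed

text \<open>Count the edges from the side of \<open>W\<close>: a light vertex has fewer than
  \<open>thr K A\<close> neighbours in \<open>A\<close>.\<close>

lemma light_fraction:
  assumes A: "A \<subseteq> V" "A \<noteq> {}" and W: "W \<subseteq> light K A" "real (card W) \<le> m" and K: "0 < K"
  shows "(\<Sum>v\<in>A. real (card (N v \<inter> W)) / real (deg E v)) \<le> 6 / 5 * K * (m / host_size A) * real (card A)"
proof -
  have finA: "finite A" using A finite_subset by blast
  have finW: "finite W" using W by (rule_tac finite_subset) (auto simp: light_def ext_nbhd_def)
  have host_size: "host_size A > 0" using finA A(2) d_pos n_pos by (simp add: host_size_def card_gt_0_iff)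
  have "(\<Sum>v\<in>A. real (card (N v \<inter> W))) = (\<Sum>u\<in>W. real (card (N u \<inter> A)))"
    by (rule sum_card_nbrs_swap[OF finA finW])
  also have "\<dots> \<le> (\<Sum>u\<in>W. thr K A)"
    using W by (intro sum_mono) (auto simp: light_def heavy_def)
  also have "\<dots> = real (card W) * thr K A" by simp
  also have "\<dots> \<le> m * thr K A"
    using W thr_eq[OF A finA, of K] K host_size d_pos by (intro mult_right_mono) auto
  finally have "(\<Sum>v\<in>A. real (card (N v \<inter> W)) / real (deg E v)) \<le> 6 / (5 * d) * (m * thr K A)"
    by (rule sum_div_deg_le[OF A(1)])
  then show ?thesis using d_pos host_size by (simp add: thr_eq[OF A finA] field_simps)
qed

end

text \<open>With l = ln n the target is n^(-3a), enough to beat the at most n^a sets of size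
  a.\<close>

lemma exp_mult_powr_le:
  fixes a k l q \<rho> :: real
  assumes "0 \<le> a" "0 < \<rho>" "\<rho> * l \<le> k" "0 \<le> l" "0 < q" "2 + ln q \<le> - (6 / \<rho>)"
  shows "exp (a * k) * q powr (a * k / 2) \<le> exp (- (3 * a * l))"
proof -
  have "exp (a * k) * q powr (a * k / 2) = exp (a * k / 2 * (2 + ln q))"
    using assms by (simp add: powr_def exp_add[symmetric] algebra_simps)
  also have "a * k / 2 * (2 + ln q) \<le> a * k / 2 * (- (6 / \<rho>))"
  proof (rule mult_left_mono)
    have "0 \<le> \<rho> * l" using assms by simp
    then have "0 \<le> k" using assms by linarith
    then show "0 \<le> a * k / 2" using assms by simp
  qed fact
  also have "\<dots> \<le> - (3 * a * l)"
  proof -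
    have "a * (\<rho> * l) \<le> a * k" using assms by (intro mult_left_mono)
    then show ?thesis using assms by (simp add: field_simps)
  qed
  finally show ?thesis by simp
qed

text \<open>The first two factors count the candidates for \<open>W\<close>, the rest bounds the
  probability for one of them.\<close>

lemma union_bound_exponent:
  fixes a k l m x K \<beta> \<rho> :: real
  assumes "0 < a" "0 < \<rho>" "\<rho> * l \<le> k" "0 < l" "1 < K" "0 < x" "x \<le> \<beta>" "m = \<beta> * a * l"
    and \<beta>: "11 * K * \<beta> \<le> exp (- (16 / \<rho>))" "\<beta> \<le> \<rho> / 4" "\<beta> * (ln (11 * K) + 4 / 3) \<le> 1"
  shows "exp (4 / 3 * m) * x powr (- m) * (exp (a * k) * (6 / 5 * K * x) powr (a * k / 2))
    \<le> exp (- (3 * a * l))"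
proof -
  \<comment> \<open>11 bounds exp 2 * 6/5, so one logarithm covers both the exponential factor and
    the power.\<close>
  define t where "t = ln (11 * K * x)"
  have pos: "0 < 11 * K * x" "0 < 6 / 5 * K * x" using assms by auto
  have "11 * K * x \<le> 11 * K * \<beta>" using assms by (intro mult_left_mono) auto
  also note \<beta>(1)
  finally have "11 * K * x \<le> exp (- (16 / \<rho>))" .
  then have t: "t \<le> - (16 / \<rho>)" using pos unfolding t_def by (metis exp_le_cancel_iff exp_ln)
  have t_eq: "t = ln (11 * K) + ln x" using assms by (simp add: t_def ln_mult)
  have "exp 2 * (6 / 5 * K * x) \<le> 11 * K * x"
  proof -
    have "exp 2 = exp 1 * exp (1::real)" by (simp add: exp_add[symmetric])
    also have "\<dots> \<le> 3 * 3" by (intro mult_mono exp_le) auto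
    finally have "exp 2 * (6 / 5 * K * x) \<le> 9 * (6 / 5 * K * x)" using pos by (intro mult_right_mono) auto
    also have "\<dots> \<le> 11 * K * x" using pos by simp
    finally show ?thesis .
  qed
  then have "ln (exp 2 * (6 / 5 * K * x)) \<le> t" unfolding t_def using pos by (subst ln_le_cancel_iff) auto
  moreover have "ln (exp 2 * y) = 2 + ln y" if "0 < y" for y :: real
    using that by (simp add: ln_mult)
  ultimately have 2: "2 + ln (6 / 5 * K * x) \<le> t" using pos by metis
  have k0: "0 \<le> k" using assms by (meson less_eq_real_def mult_pos_pos order_trans)
  have "exp (4 / 3 * m) * x powr (- m) * (exp (a * k) * (6 / 5 * K * x) powr (a * k / 2))
      = exp (4 / 3 * m - m * ln x + a * k / 2 * (2 + ln (6 / 5 * K * x)))"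
    using pos assms by (simp add: powr_def exp_add[symmetric] algebra_simps)
  also have "4 / 3 * m - m * ln x + a * k / 2 * (2 + ln (6 / 5 * K * x))
      \<le> 4 / 3 * m - m * ln x + a * k / 2 * t"
    using 2 k0 assms by (intro add_left_mono mult_left_mono) auto
  also have "\<dots> \<le> 4 / 3 * m - m * ln x + a * (\<rho> * l) / 2 * t"
  proof -
    have "0 \<le> 16 / \<rho>" using assms by simp
    then have "t \<le> 0" using t by linarith
    moreover have "a * (\<rho> * l) / 2 \<le> a * k / 2" using assms by simp
    ultimately show ?thesis by (intro add_left_mono mult_right_mono_neg)
  qed
  \<comment> \<open>The entropy term - m ln x is absorbed into t. As \<beta> <= \<rho>/4, at least
    half of the coefficient of t survives, and t <= -16/\<rho> makes it worth -4 a l; the first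
    summand is at most a l.\<close>
  also have "\<dots> = m * (ln (11 * K) + 4 / 3) + (a * (\<rho> * l) / 2 - m) * t"
    by (simp add: t_eq algebra_simps)
  also have "\<dots> \<le> a * l + (a * (\<rho> * l) / 4) * (- (16 / \<rho>))"
  proof (rule add_mono)
    have "(a * l) * (\<beta> * (ln (11 * K) + 4 / 3)) \<le> (a * l) * 1"
      using \<beta>(3) assms by (intro mult_left_mono) auto
    then show "m * (ln (11 * K) + 4 / 3) \<le> a * l" using assms by (simp add: algebra_simps)
    have "m = a * l * \<beta>" using assms by simp
    also have "\<dots> \<le> a * l * (\<rho> / 4)" using \<beta>(2) assms by (intro mult_left_mono) auto
    also have "\<dots> = a * (\<rho> * l) / 4" by simp
    finally have le: "a * (\<rho> * l) / 4 \<le> a * (\<rho> * l) / 2 - m" by linarith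
    have nn: "0 \<le> a * (\<rho> * l) / 4" using assms by simp
    have "(a * (\<rho> * l) / 2 - m) * t \<le> (a * (\<rho> * l) / 2 - m) * (- (16 / \<rho>))"
      by (rule mult_left_mono[OF t order.trans[OF nn le]])
    also have "\<dots> \<le> (a * (\<rho> * l) / 4) * (- (16 / \<rho>))"
      using le assms by (intro mult_right_mono_neg) auto
    finally show "(a * (\<rho> * l) / 2 - m) * t \<le> (a * (\<rho> * l) / 4) * (- (16 / \<rho>))" .
  qed
  also have "\<dots> = - (3 * a * l)" using assms by (simp add: field_simps)
  finally show ?thesis by simp
qed

context sparse_graph
begin

lemma prob_small_trace_nbhd:
  assumes A: "A \<subseteq> V" "A \<noteq> {}" "real (card A) \<le> real n / ln (real n)"
    and K: "K0 \<le> K" "1 < K" "K * ln K \<le> ln (real n)" "2 + ln (54 / (5 * ln K)) \<le> - (6 / \<rho>)"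
    and \<rho>: "0 < \<rho>" "\<rho> * ln (real n) \<le> real k"
    and \<beta>: "0 < \<beta>" "\<beta> \<le> 1" "11 * K * \<beta> \<le> exp (- (16 / \<rho>))" "\<beta> \<le> \<rho> / 4" "\<beta> * (ln (11 * K) + 4 / 3) \<le> 1"
    and x: "x \<in> V"
  shows "measure_pmf.prob (lazy_walk E x L)
      {xs. (\<forall>v\<in>A. k \<le> length (exits v xs)) \<and>
           real (card (ext_nbhd n (set_mset (trace_of xs)) A)) < real (card A) * \<beta> * ln (real n)}
    \<le> 2 * exp (- (3 * real (card A) * ln (real n)))"
proof -
  let ?a = "real (card A)" and ?l = "ln (real n)" and ?U = "light K A"
  define m where "m = \<beta> * ?a * ?l"
  \<comment> \<open>One density serves twice: as counting parameter for the sets \<open>W\<close>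
    and, up to 6/5 * K, as the probability of landing in one of them. It is at most \<beta> because
    \<open>host_size A\<close> is at least |A| ln n.\<close>
  define z where "z = m / host_size A"
  have finA: "finite A" using A finite_subset by blast
  have a_pos: "0 < ?a" using finA A by (simp add: card_gt_0_iff)
  have l_pos: "0 < ?l" using ln_ge by linarith
  have d_ge: "?l \<le> d" using \<alpha>_ge ln_ge by (simp add: d_def)
  have host_size: "?a * ?l \<le> host_size A" "0 < host_size A"
    using A(3) l_pos d_ge d_pos a_pos n_pos by (auto simp: host_size_def pos_le_divide_eq mult_left_mono)
  have m_pos: "0 < m" using a_pos l_pos \<beta> by (simp add: m_def)
  have z: "0 < z" "z \<le> \<beta>"
  proof -
    show "0 < z" using m_pos host_size by (simp add: z_def)
    have "m \<le> \<beta> * host_size A" using host_size \<beta> unfolding m_def by (simp add: mult.assoc mult_left_mono)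
    then show "z \<le> \<beta>" using host_size by (simp add: z_def field_simps)
  qed
  have finU: "finite ?U" by (simp add: light_def ext_nbhd_def)
  define half where "half = (\<lambda>S. {xs. (\<forall>v\<in>A. k \<le> length (exits v xs)) \<and>
           card A * k \<le> 2 * (\<Sum>v\<in>A. length (filter (\<lambda>u. u \<in> S) (take k (exits v xs))))})"
  define \<W> where "\<W> = {W. W \<subseteq> ?U \<and> real (card W) \<le> m}"
  have fin\<W>: "finite \<W>" unfolding \<W>_def using finU by simp
  have "{xs. (\<forall>v\<in>A. k \<le> length (exits v xs)) \<and>
           real (card (ext_nbhd n (set_mset (trace_of xs)) A)) < ?a * \<beta> * ?l}
      \<subseteq> half (- ?U) \<union> (\<Union>W\<in>\<W>. half W)"
  proof clarify
    fix xs
    assume len: "\<forall>v\<in>A. k \<le> length (exits v xs)"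
      and small: "real (card (ext_nbhd n (set_mset (trace_of xs)) A)) < ?a * \<beta> * ?l"
      and no: "xs \<notin> (\<Union>W\<in>\<W>. half W)"
    \<comment> \<open>Every departure from \<open>A\<close> ends outside the light set or in this
      \<open>W\<close>; if fewer than half end in \<open>W\<close>, more than half miss the light
      set.\<close>
    define W where "W = ?U \<inter> ext_nbhd n (set_mset (trace_of xs)) A"
    have "card W \<le> card (ext_nbhd n (set_mset (trace_of xs)) A)"
      unfolding W_def by (intro card_mono) (auto simp: ext_nbhd_def)
    then have "W \<in> \<W>" using small by (auto simp: \<W>_def W_def m_def mult_ac)
    then have notW: "xs \<notin> half W" using no by blast
    have split: "length (filter (\<lambda>u. u \<in> - ?U) (take k (exits v xs)))
        + length (filter (\<lambda>u. u \<in> W) (take k (exits v xs))) = k" if v: "v \<in> A" for v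
    proof -
      have "filter (\<lambda>u. u \<in> W) (take k (exits v xs)) = filter (\<lambda>u. \<not> u \<in> - ?U) (take k (exits v xs))"
      proof (rule filter_cong[OF refl])
        fix u assume "u \<in> set (take k (exits v xs))"
        then have "u \<in> set (exits v xs)" by (rule in_set_takeD)
        then have "{v, u} \<in> set_mset (trace_of xs)" by (rule exits_in_trace)
        then show "(u \<in> W) = (\<not> u \<in> - ?U)"
          using v by (auto simp: W_def light_def ext_nbhd_def insert_commute)
      qed
      then show ?thesis using len v by (simp add: sum_length_filter_compl min_absorb2 del: Compl_iff)
    qed
    have "(\<Sum>v\<in>A. length (filter (\<lambda>u. u \<in> - ?U) (take k (exits v xs))))
        + (\<Sum>v\<in>A. length (filter (\<lambda>u. u \<in> W) (take k (exits v xs)))) = card A * k"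
      by (subst sum.distrib[symmetric]) (simp only: split cong: sum.cong, simp)
    moreover have "\<not> card A * k \<le> 2 * (\<Sum>v\<in>A. length (filter (\<lambda>u. u \<in> W) (take k (exits v xs))))"
      using notW len by (simp add: half_def)
    ultimately show "xs \<in> half (- ?U)" using len unfolding half_def by simp
  qed
  then have "measure_pmf.prob (lazy_walk E x L) {xs. (\<forall>v\<in>A. k \<le> length (exits v xs)) \<and>
           real (card (ext_nbhd n (set_mset (trace_of xs)) A)) < ?a * \<beta> * ?l}
      \<le> measure_pmf.prob (lazy_walk E x L) (half (- ?U) \<union> (\<Union>W\<in>\<W>. half W))"
    by (intro measure_pmf.finite_measure_mono) auto
  also have "\<dots> \<le> measure_pmf.prob (lazy_walk E x L) (half (- ?U))
      + measure_pmf.prob (lazy_walk E x L) (\<Union>W\<in>\<W>. half W)"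
    by (rule measure_Un_le) auto
  also have "\<dots> \<le> measure_pmf.prob (lazy_walk E x L) (half (- ?U))
      + (\<Sum>W\<in>\<W>. measure_pmf.prob (lazy_walk E x L) (half W))"
    by (intro add_left_mono measure_UNION_le fin\<W>) auto
  also have "\<dots> \<le> exp (- (3 * ?a * ?l)) + exp (- (3 * ?a * ?l))"
  proof (rule add_mono)
    have lnK: "0 < ln K" using K by simp
    have "measure_pmf.prob (lazy_walk E x L) (half (- ?U))
       \<le> exp (real (card A * k)) * (54 / (5 * ln K)) powr (real (card A * k) / 2)"
      unfolding half_def
      by (rule prob_half_exits_in[OF A(1) x _ not_light_fraction[OF A K(1,2,3)]]) (use lnK in simp)
    also have "\<dots> \<le> exp (- (3 * ?a * ?l))"
      using exp_mult_powr_le[of ?a \<rho> ?l "real k" "54 / (5 * ln K)"] a_pos \<rho> l_pos lnK K by simp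
    finally show "measure_pmf.prob (lazy_walk E x L) (half (- ?U)) \<le> exp (- (3 * ?a * ?l))" .
    have "(\<Sum>W\<in>\<W>. measure_pmf.prob (lazy_walk E x L) (half W))
      \<le> (\<Sum>W\<in>\<W>. exp (real (card A * k)) * (6 / 5 * K * z) powr (real (card A * k) / 2))"
    proof (rule sum_mono)
      fix W assume "W \<in> \<W>"
      then have W: "W \<subseteq> light K A" "real (card W) \<le> m" by (auto simp: \<W>_def)
      show "measure_pmf.prob (lazy_walk E x L) (half W)
          \<le> exp (real (card A * k)) * (6 / 5 * K * z) powr (real (card A * k) / 2)"
        unfolding half_def
      proof (rule prob_half_exits_in[OF A(1) x])
        show "0 < 6 / 5 * K * z" using z K by simp
        show "(\<Sum>v\<in>A. real (card (N v \<inter> W)) / real (deg E v)) \<le> 6 / 5 * K * z * real (card A)"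
          unfolding z_def by (rule light_fraction[OF A(1,2) W]) (use K in simp)
      qed
    qed
    also have "\<dots> = real (card \<W>) * (exp (?a * real k) * (6 / 5 * K * z) powr (?a * real k / 2))" by simp
    also have "\<dots> \<le> (exp (z * real (card ?U)) * z powr (- m)) *
        (exp (?a * real k) * (6 / 5 * K * z) powr (?a * real k / 2))"
      unfolding \<W>_def using z \<beta> finU by (intro mult_right_mono card_small_subsets_le) auto
    also have "\<dots> \<le> (exp (4 / 3 * m) * z powr (- m)) *
        (exp (?a * real k) * (6 / 5 * K * z) powr (?a * real k / 2))"
    proof -
      have "z * real (card ?U) \<le> z * (4 / 3 * host_size A)"
        using z card_light_le[OF A(1)] by (intro mult_left_mono) auto
      also have "\<dots> = 4 / 3 * m" using host_size by (simp add: z_def)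
      finally show ?thesis by (intro mult_right_mono) auto
    qed
    also have "\<dots> \<le> exp (- (3 * ?a * ?l))"
      by (rule union_bound_exponent[of ?a \<rho> ?l "real k" K z \<beta> m])
        (use a_pos \<rho> l_pos K z \<beta> in \<open>auto simp: m_def\<close>)
    finally show "(\<Sum>W\<in>\<W>. measure_pmf.prob (lazy_walk E x L) (half W)) \<le> exp (- (3 * ?a * ?l))" .
  qed
  finally show ?thesis by simp
qed

lemma prob_not_E1:
  assumes K: "K0 \<le> K" "1 < K" "K * ln K \<le> ln (real n)" "2 + ln (54 / (5 * ln K)) \<le> - (6 / \<rho>)"
    and \<rho>: "0 < \<rho>" "\<rho> * ln (real n) \<le> real k"
    and \<beta>: "0 < \<beta>" "\<beta> \<le> 1" "11 * K * \<beta> \<le> exp (- (16 / \<rho>))" "\<beta> \<le> \<rho> / 4" "\<beta> * (ln (11 * K) + 4 / 3) \<le> 1"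
    and x: "x \<in> V"
  shows "measure_pmf.prob (lazy_walk E x L)
      {xs. (\<forall>v\<in>V. k \<le> length (exits v xs)) \<and> \<not> E1 \<beta> n (trace_of xs)}
    \<le> 2 * (exp (1 / (real n)\<^sup>2) - 1)"
proof -
  define \<A> where "\<A> = {A. A \<subseteq> V \<and> A \<noteq> {} \<and> real (card A) \<le> real n / ln (real n)}"
  define bad where "bad = (\<lambda>A. {xs. (\<forall>v\<in>A. k \<le> length (exits v xs)) \<and>
           real (card (ext_nbhd n (set_mset (trace_of xs)) A)) < real (card A) * \<beta> * ln (real n)})"
  have fin: "finite \<A>" by (rule finite_subset[of _ "Pow V"]) (auto simp: \<A>_def)
  have "{xs. (\<forall>v\<in>V. k \<le> length (exits v xs)) \<and> \<not> E1 \<beta> n (trace_of xs)} \<subseteq> (\<Union>A\<in>\<A>. bad A)"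
  proof clarify
    fix xs assume len: "\<forall>v\<in>V. k \<le> length (exits v xs)" and "\<not> E1 \<beta> n (trace_of xs)"
    then obtain A where A: "A \<subseteq> V" "real (card A) \<le> real n / ln (real n)"
      "real (card (ext_nbhd n (set_mset (trace_of xs)) A)) < real (card A) * \<beta> * ln (real n)"
      unfolding E1_def by (meson not_le)
    have "A \<noteq> {}" using A(3) by auto
    then show "xs \<in> (\<Union>A\<in>\<A>. bad A)" using A len by (intro UN_I[of A]) (auto simp: \<A>_def bad_def)
  qed
  then have "measure_pmf.prob (lazy_walk E x L)
      {xs. (\<forall>v\<in>V. k \<le> length (exits v xs)) \<and> \<not> E1 \<beta> n (trace_of xs)}
     \<le> measure_pmf.prob (lazy_walk E x L) (\<Union>A\<in>\<A>. bad A)"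
    by (intro measure_pmf.finite_measure_mono) auto
  also have "\<dots> \<le> (\<Sum>A\<in>\<A>. measure_pmf.prob (lazy_walk E x L) (bad A))"
    by (intro measure_UNION_le fin) auto
  also have "\<dots> \<le> (\<Sum>A\<in>\<A>. 2 * (1 / real n ^ 3) ^ card A)"
  proof (rule sum_mono)
    fix A assume "A \<in> \<A>"
    then have "measure_pmf.prob (lazy_walk E x L) (bad A) \<le> 2 * exp (- (3 * real (card A) * ln (real n)))"
      unfolding bad_def using assms by (intro prob_small_trace_nbhd) (auto simp: \<A>_def)
    also have "exp (- (3 * real (card A) * ln (real n))) = (1 / real n ^ 3) ^ card A"
    proof -
      have "exp (- (3 * real (card A) * ln (real n))) = exp (- (3 * ln (real n))) ^ card A"
        by (simp add: exp_of_nat_mult[symmetric] algebra_simps)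
      also have "exp (- (3 * ln (real n))) = 1 / exp (ln (real n)) ^ 3"
        by (simp add: exp_minus exp_of_nat_mult[symmetric] divide_inverse)
      finally show ?thesis using n_pos by simp
    qed
    finally show "measure_pmf.prob (lazy_walk E x L) (bad A) \<le> 2 * (1 / real n ^ 3) ^ card A" .
  qed
  also have "\<dots> \<le> (\<Sum>A\<in>Pow V - {{}}. 2 * (1 / real n ^ 3) ^ card A)"
    by (rule sum_mono2) (auto simp: \<A>_def)
  \<comment> \<open>The binomial theorem sums n^(-3|A|) over all sets; the -1 removes the empty set,
    for which (E1) is trivial.\<close>
  also have "\<dots> = 2 * ((1 + 1 / real n ^ 3) ^ n - 1)"
    using sum_Pow_power[of V "1 / real n ^ 3"]
    by (simp add: sum_distrib_left[symmetric] sum_diff1)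
  also have "(1 + 1 / real n ^ 3) ^ n \<le> exp (1 / real n ^ 3) ^ n"
    by (intro power_mono exp_ge_add_one_self) auto
  also have "\<dots> = exp (1 / (real n)\<^sup>2)"
    using n_pos by (simp add: exp_of_nat_mult[symmetric] power2_eq_square power3_eq_cube)
  finally show ?thesis by simp
qed

end

section \<open>Edges of the trace between large sets\<close>

context sparse_graph
begin

text \<open>There are at most exp(2a(1 + ln ln n)) pairs, each failing with probability at most
  exp(-(3\<rho>/16) w a). The exponent 3/2 in \<open>w\<close> is what makes w outgrow ln ln
  n.\<close>

lemma prob_not_E2:
  fixes \<rho> :: real
  defines "w \<equiv> ln (ln (real n)) powr (3 / 2)"
  assumes P5: "P5 \<alpha> n E"
    and w: "1 \<le> w" "2 * (1 + ln (ln (real n))) + 1 \<le> 3 * \<rho> / 16 * w"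
    and \<rho>: "0 < \<rho>" "\<rho> * ln (real n) \<le> real k"
    and x: "x \<in> V"
  shows "measure_pmf.prob (lazy_walk E x L)
      {xs. (\<forall>v\<in>V. k \<le> length (exits v xs)) \<and> \<not> E2 n (trace_of xs)}
    \<le> exp (- (real n / ln (real n)))"
proof -
  let ?l = "ln (real n)"
  define a where "a = nat \<lceil>large_size n\<rceil>"
  define \<A> where "\<A> = {A. A \<subseteq> V \<and> card A = a}"
  define bad where "bad = (\<lambda>(A, B). {xs. (\<forall>v\<in>V. k \<le> length (exits v xs)) \<and>
      edges_between (set_mset (trace_of xs)) A B = {}})"
  have l: "1 \<le> ?l" by (rule ln_ge)
  have ls: "real n / ?l \<le> large_size n"
    using w(1) l n_pos unfolding large_size_def w_def[symmetric] by (simp add: divide_right_mono)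
  have ls_pos: "0 < large_size n"
  proof -
    have "0 < ?l" using l by linarith
    then have "0 < real n / ?l" using n_pos by simp
    then show ?thesis using ls by linarith
  qed
  have a_ge: "large_size n \<le> real a" "real n / ?l \<le> real a" and a_int: "int a = \<lceil>large_size n\<rceil>"
    using ls ls_pos unfolding a_def by linarith+
  have card_ge: "a \<le> card A" if "large_size n \<le> real (card A)" for A :: "nat set"
    using that unfolding a_def by linarith
  have fin: "finite \<A>" by (rule finite_subset[of _ "Pow V"]) (auto simp: \<A>_def)
  have card\<A>: "real (card \<A>) \<le> exp (real a * (1 + ln ?l))"
  proof -
    have "card \<A> \<le> card {W. W \<subseteq> V \<and> real (card W) \<le> real a}"
      by (rule card_mono) (auto simp: \<A>_def)
    also have "real \<dots> \<le> exp (1 / ?l * real (card V)) * (1 / ?l) powr (- real a)"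
      using l by (intro card_small_subsets_le) auto
    also have "\<dots> = exp (real n / ?l + real a * ln ?l)"
      using l by (simp add: powr_def exp_add ln_div)
    also have "\<dots> \<le> exp (real a * (1 + ln ?l))" using a_ge(2) by (simp add: algebra_simps)
    finally show ?thesis by simp
  qed
  have "{xs. (\<forall>v\<in>V. k \<le> length (exits v xs)) \<and> \<not> E2 n (trace_of xs)}
      \<subseteq> (\<Union>p\<in>{(A, B). A \<in> \<A> \<and> B \<in> \<A> \<and> A \<inter> B = {}}. bad p)"
  proof clarify
    fix xs assume len: "\<forall>v\<in>V. k \<le> length (exits v xs)" and "\<not> E2 n (trace_of xs)"
    then obtain A B where AB: "A \<subseteq> V" "B \<subseteq> V" "A \<inter> B = {}" "large_size n \<le> real (card A)"
      "large_size n \<le> real (card B)" "edges_between (set_mset (trace_of xs)) A B = {}"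
      unfolding E2_def by blast
    \<comment> \<open>Shrinking to the exact size is harmless for the absence of edges, and (P5)
      speaks of that size only.\<close>
    obtain A' where A': "A' \<subseteq> A" "card A' = a" using obtain_subset_with_card_n[OF card_ge[OF AB(4)]] by blast
    obtain B' where B': "B' \<subseteq> B" "card B' = a" using obtain_subset_with_card_n[OF card_ge[OF AB(5)]] by blast
    have "edges_between (set_mset (trace_of xs)) A' B' \<subseteq> edges_between (set_mset (trace_of xs)) A B"
      using A' B' unfolding edges_between_def by blast
    then show "xs \<in> (\<Union>p\<in>{(A, B). A \<in> \<A> \<and> B \<in> \<A> \<and> A \<inter> B = {}}. bad p)"
      using A' B' AB len by (intro UN_I[of "(A', B')"]) (auto simp: \<A>_def bad_def)
  qed
  then have "measure_pmf.prob (lazy_walk E x L)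
      {xs. (\<forall>v\<in>V. k \<le> length (exits v xs)) \<and> \<not> E2 n (trace_of xs)}
     \<le> measure_pmf.prob (lazy_walk E x L) (\<Union>p\<in>{(A, B). A \<in> \<A> \<and> B \<in> \<A> \<and> A \<inter> B = {}}. bad p)"
    by (intro measure_pmf.finite_measure_mono) auto
  also have "\<dots> \<le> (\<Sum>p\<in>{(A, B). A \<in> \<A> \<and> B \<in> \<A> \<and> A \<inter> B = {}}. measure_pmf.prob (lazy_walk E x L) (bad p))"
    by (intro measure_UNION_le finite_subset[OF _ finite_cartesian_product[OF fin fin]]) auto
  also have "\<dots> \<le> (\<Sum>p\<in>{(A, B). A \<in> \<A> \<and> B \<in> \<A> \<and> A \<inter> B = {}}. exp (- (3 * \<rho> / 16 * w * real a)))"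
  proof (intro sum_mono, clarify)
    fix A B assume "A \<in> \<A>" "B \<in> \<A>" and disj: "A \<inter> B = {}"
    then have A: "A \<subseteq> V" "card A = a" and B: "B \<subseteq> V" "card B = a" by (auto simp: \<A>_def)
    have finA: "finite A" "finite B" using A B finite_subset by blast+
    define D where "D = {v \<in> B. \<alpha> * w / 2 < real (card (N v \<inter> A))}"
    define poor where "poor = {v \<in> V - A. real (card (edges_between E {v} A)) \<le> \<alpha> * w / 2}"
    have D: "D \<subseteq> V" "finite D" using B finA by (auto simp: D_def)
    have "real (card poor) \<le> real (card A) / 2"
      using P5 A a_int unfolding P5_def poor_def w_def by auto
    moreover have "card B \<le> card D + card poor"
    proof -
      have "B \<subseteq> D \<union> poor"
      proof
        fix v assume v: "v \<in> B"
        then have "v \<in> V - A" "v \<notin> A" using B(1) disj by blast+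
        then show "v \<in> D \<union> poor"
          using v card_edges_between_single[OF _ finA(1), of v] by (auto simp: D_def poor_def not_less)
      qed
      then have "card B \<le> card (D \<union> poor)" using D by (intro card_mono) (auto simp: poor_def)
      then show ?thesis using card_Un_le[of D poor] by linarith
    qed
    ultimately have cardD: "real a / 2 \<le> real (card D)" using A B by linarith
    have "bad (A, B) \<subseteq> {xs. \<forall>v\<in>D. k \<le> length (exits v xs) \<and> set (exits v xs) \<inter> A = {}}"
    proof clarify
      fix xs v assume xs: "xs \<in> bad (A, B)" and v: "v \<in> D"
      have "u \<notin> A" if "u \<in> set (exits v xs)" for u
        using exits_in_trace[OF that] xs v by (auto simp: bad_def edges_between_def D_def insert_commute)
      then show "k \<le> length (exits v xs) \<and> set (exits v xs) \<inter> A = {}"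
        using xs v D by (auto simp: bad_def)
    qed
    then have "measure_pmf.prob (lazy_walk E x L) (bad (A, B))
        \<le> measure_pmf.prob (lazy_walk E x L) {xs. \<forall>v\<in>D. k \<le> length (exits v xs) \<and> set (exits v xs) \<inter> A = {}}"
      by (intro measure_pmf.finite_measure_mono) auto
    \<comment> \<open>The fraction of edges into \<open>A\<close> is at least (\<alpha> w / 2) /
      (4/3 * \<alpha> ln n) = 3 w / (8 ln n); the 16 appears because \<open>D\<close> is only half
      of \<open>B\<close>.\<close>
    also have "\<dots> \<le> exp (- (3 / 8 * w / ?l * real k * real (card D)))"
    proof (rule prob_exits_avoid[OF D(1) x])
      fix v assume v: "v \<in> D"
      have "3 / 8 * w / ?l * real (deg E v) \<le> 3 / 8 * w / ?l * (4 / 3 * d)"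
        using v D deg_upper l w(1) by (intro mult_left_mono) auto
      also have "\<dots> = \<alpha> * w / 2" using l by (simp add: d_def)
      finally show "3 / 8 * w / ?l * real (deg E v) \<le> real (card (N v \<inter> A))"
        using v by (simp add: D_def)
    qed
    also have "\<dots> \<le> exp (- (3 * \<rho> / 16 * w * real a))"
    proof -
      have "3 * \<rho> / 16 * w * real a = 3 / 8 * w / ?l * (\<rho> * ?l) * (real a / 2)" using l by auto
      also have "\<dots> \<le> 3 / 8 * w / ?l * real k * real (card D)"
        using \<rho> cardD l w(1) by (intro mult_mono) auto
      finally show ?thesis by (simp only: exp_le_cancel_iff neg_le_iff_le)
    qed
    finally show "measure_pmf.prob (lazy_walk E x L) (bad (A, B)) \<le> exp (- (3 * \<rho> / 16 * w * real a))" .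
  qed
  also have "\<dots> \<le> (\<Sum>p\<in>\<A> \<times> \<A>. exp (- (3 * \<rho> / 16 * w * real a)))"
    using fin by (intro sum_mono2) auto
  also have "\<dots> = real (card \<A>) * real (card \<A>) * exp (- (3 * \<rho> / 16 * w * real a))"
    by (simp add: card_cartesian_product)
  also have "\<dots> \<le> exp (real a * (1 + ln ?l)) * exp (real a * (1 + ln ?l)) * exp (- (3 * \<rho> / 16 * w * real a))"
    using card\<A> by (intro mult_right_mono mult_mono) auto
  also have "\<dots> = exp (real a * (2 * (1 + ln ?l) - 3 * \<rho> / 16 * w))"
    by (simp add: exp_add[symmetric] algebra_simps)
  also have "\<dots> \<le> exp (real a * (- 1))" using w(2) by (subst exp_le_cancel_iff) (intro mult_left_mono, auto)
  also have "\<dots> \<le> exp (- (real n / ?l))" using a_ge(2) by simp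
  finally show ?thesis .
qed

end

section \<open>The length of the walk\<close>

text \<open>456 * 9/1024 exceeds 4, so the squared mixing error is at most of order n^(-4).\<close>

definition mix_time :: "nat \<Rightarrow> nat" where
  "mix_time n = nat \<lceil>456 * ln (real n)\<rceil>"

text \<open>\<open>visit_rate \<epsilon> n * ln n\<close> is a lower bound for the expected number of blocks of length
  \<open>(mix_time n)\<^sup>2\<close> in which the walk leaves a given vertex. Up to normalisation, the factors are
  the expected number of departures from the vertex in a block, the inverse of that number given at
  least one departure, and the number of blocks.\<close>

definition visit_rate :: "real \<Rightarrow> nat \<Rightarrow> real" where
  "visit_rate \<epsilon> n =
     (1 - 1 / real (mix_time n)) * ((1 - \<epsilon> / 9) - 2 / real n) / 2 /
     (1 + \<epsilon> / 50 + (8 / 5 * ((real (mix_time n))\<^sup>2 / real n) + 2 * ((real (mix_time n))\<^sup>2 / (real n)\<^sup>2)) / 2) *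
     ((2 + \<epsilon>) - 1 / (real n * ln (real n)) - (real (mix_time n))\<^sup>2 / (real n * ln (real n)))"

lemma eventually_visit_rate:
  assumes \<epsilon>: "0 < \<epsilon>" "\<epsilon> < 1 / 10"
  shows "\<forall>\<^sub>F n in sequentially. 1 + \<epsilon> / 5 \<le> visit_rate \<epsilon> n"
proof -
  have 1: "(\<lambda>n. 1 / real (mix_time n)) \<longlonglongrightarrow> 0" unfolding mix_time_def by real_asymp
  have 2: "(\<lambda>n. 2 / real n) \<longlonglongrightarrow> 0" by real_asymp
  have 3: "(\<lambda>n. (real (mix_time n))\<^sup>2 / real n) \<longlonglongrightarrow> 0" unfolding mix_time_def by real_asymp
  have 4: "(\<lambda>n. (real (mix_time n))\<^sup>2 / (real n)\<^sup>2) \<longlonglongrightarrow> 0" unfolding mix_time_def by real_asymp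
  have 5: "(\<lambda>n. 1 / (real n * ln (real n))) \<longlonglongrightarrow> 0" by real_asymp
  have 6: "(\<lambda>n. (real (mix_time n))\<^sup>2 / (real n * ln (real n))) \<longlonglongrightarrow> 0" unfolding mix_time_def by real_asymp
  have "visit_rate \<epsilon> \<longlonglongrightarrow>
     (1 - 0) * ((1 - \<epsilon> / 9) - 0) / 2 / (1 + \<epsilon> / 50 + (8 / 5 * 0 + 2 * 0) / 2) * ((2 + \<epsilon>) - 0 - 0)"
    unfolding visit_rate_def[abs_def] using \<epsilon>
    by (intro tendsto_intros 1 2 3 4 5 6) auto
  \<comment> \<open>To first order in \<epsilon> this is 1/5 + 1/50 < 1/2 - 1/9; \<epsilon> < 1/10
    absorbs the quadratic terms.\<close>
  moreover have "1 + \<epsilon> / 5 < (1 - 0) * ((1 - \<epsilon> / 9) - 0) / 2 / (1 + \<epsilon> / 50 + (8 / 5 * 0 + 2 * 0) / 2) * ((2 + \<epsilon>) - 0 - 0)"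
  proof -
    define q where "q = \<epsilon> * \<epsilon>"
    have q: "q \<le> 1 / 10 * \<epsilon>" using \<epsilon> unfolding q_def by (intro mult_right_mono) auto
    have e1: "(1 + \<epsilon> / 5) * (1 + \<epsilon> / 50) = 1 + 11 / 50 * \<epsilon> + q / 250"
      unfolding q_def by (simp add: algebra_simps add_divide_distrib diff_divide_distrib)
    have e2: "(1 - \<epsilon> / 9) / 2 * (2 + \<epsilon>) = 1 + 7 / 18 * \<epsilon> - q / 18"
      unfolding q_def by (simp add: algebra_simps add_divide_distrib diff_divide_distrib)
    have "(1 + \<epsilon> / 5) * (1 + \<epsilon> / 50) < (1 - \<epsilon> / 9) / 2 * (2 + \<epsilon>)"
      unfolding e1 e2 using q \<epsilon> by linarith
    then show ?thesis using \<epsilon> by (simp add: field_simps)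
  qed
  ultimately have "\<forall>\<^sub>F n in sequentially. 1 + \<epsilon> / 5 < visit_rate \<epsilon> n" by (rule order_tendstoD)
  then show ?thesis by (rule eventually_mono) simp
qed

context expander
begin

text \<open>Put r = sqrt \<alpha>. All degrees lie within 2 r ln n of r^2 ln n, and r >=
  36/\<epsilon>, by 36^2 <= 1500, makes the quotient of the extremes at least 1 -
  \<epsilon>/9.\<close>

lemma stationary_ge:
  assumes \<epsilon>: "0 < \<epsilon>" and \<alpha>: "1500 / \<epsilon>\<^sup>2 \<le> \<alpha>" and l: "0 < l"
    and dev: "\<And>v. v \<in> V \<Longrightarrow> \<bar>real (deg E v) - \<alpha> * l\<bar> \<le> 2 * sqrt \<alpha> * l"
    and v: "v \<in> V"
  shows "(1 - \<epsilon> / 9) / real n \<le> real (deg E v) / total"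
proof -
  define r where "r = sqrt \<alpha>"
  have "(36 / \<epsilon>)\<^sup>2 \<le> 1500 / \<epsilon>\<^sup>2" by (simp add: power_divide divide_right_mono)
  then have "(36 / \<epsilon>)\<^sup>2 \<le> \<alpha>" using \<alpha> by linarith
  then have "36 / \<epsilon> \<le> r" unfolding r_def by (rule real_le_rsqrt)
  then have r: "36 \<le> \<epsilon> * r" using \<epsilon> by (simp add: field_simps)
  then have r0: "0 < r" using \<epsilon> zero_less_mult_pos[of \<epsilon> r] by linarith
  have \<alpha>r: "\<alpha> = r\<^sup>2" using r0 unfolding r_def by simp
  have dev': "\<bar>real (deg E u) - r\<^sup>2 * l\<bar> \<le> 2 * r * l" if "u \<in> V" for u
    using dev[OF that] unfolding r_def[symmetric] unfolding \<alpha>r .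
  have "total \<le> (\<Sum>v\<in>V. (r\<^sup>2 + 2 * r) * l)"
    unfolding total_def
  proof (rule sum_mono)
    fix u assume "u \<in> V"
    from dev'[OF this] show "real (deg E u) \<le> (r\<^sup>2 + 2 * r) * l"
      by (simp add: algebra_simps abs_le_iff)
  qed
  then have tot: "total \<le> real n * ((r\<^sup>2 + 2 * r) * l)" by simp
  have key: "(1 - \<epsilon> / 9) * (r\<^sup>2 + 2 * r) \<le> r\<^sup>2 - 2 * r"
  proof -
    have "r * 4 \<le> r * (\<epsilon> / 9 * (r + 2))"
      using r r0 \<epsilon> by (intro mult_left_mono) (auto simp: algebra_simps)
    then show ?thesis by (simp add: power2_eq_square algebra_simps)
  qed
  have up: "(r\<^sup>2 - 2 * r) * l \<le> real (deg E v)"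
    using dev'[OF v] by (simp add: algebra_simps abs_le_iff)
  show ?thesis
  proof (cases "1 - \<epsilon> / 9 \<le> 0")
    case True
    then have "(1 - \<epsilon> / 9) / real n \<le> 0" by (simp add: divide_nonpos_nonneg)
    also have "0 \<le> real (deg E v) / total" using total_pos by simp
    finally show ?thesis .
  next
    case False
    have "(1 - \<epsilon> / 9) * total \<le> (1 - \<epsilon> / 9) * (real n * ((r\<^sup>2 + 2 * r) * l))"
      using False tot by (intro mult_left_mono) auto
    also have "\<dots> = real n * l * ((1 - \<epsilon> / 9) * (r\<^sup>2 + 2 * r))" by (simp add: mult_ac)
    also have "\<dots> \<le> real n * l * (r\<^sup>2 - 2 * r)" using key l by (intro mult_left_mono) auto
    also have "\<dots> = real n * ((r\<^sup>2 - 2 * r) * l)" by (simp add: mult_ac)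
    also have "\<dots> \<le> real n * real (deg E v)" using up by (intro mult_left_mono) auto
    finally show ?thesis using total_pos n_pos by (simp add: field_simps)
  qed
qed

lemma mix_time_error:
  assumes l: "1 \<le> ln (real n)"
  shows "2 * sqrt ((1 - 9 / 1024) ^ mix_time n) \<le> 2 / (real n)\<^sup>2"
proof -
  have T: "456 * ln (real n) \<le> real (mix_time n)" unfolding mix_time_def by linarith
  have "(1 - 9 / 1024 :: real) ^ mix_time n \<le> exp (- (9 / 1024)) ^ mix_time n"
    using exp_ge_add_one_self[of "- (9 / 1024 :: real)"] by (intro power_mono) auto
  also have "\<dots> = exp (- (9 / 1024 * real (mix_time n)))" by (simp add: exp_of_nat_mult[symmetric] mult.commute)
  also have "\<dots> \<le> exp (- (4 * ln (real n)))" using T l by simp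
  also have "\<dots> = (1 / (real n)\<^sup>2)\<^sup>2"
  proof -
    have "exp (4 * ln (real n)) = real n ^ 4"
      using exp_of_nat_mult[of 4 "ln (real n)"] n_pos by simp
    then show ?thesis by (simp add: exp_minus divide_inverse power_inverse flip: power_mult)
  qed
  finally have "sqrt ((1 - 9 / 1024) ^ mix_time n) \<le> 1 / (real n)\<^sup>2"
    by (intro real_le_lsqrt) auto
  then show ?thesis by simp
qed

lemma prob_few_exits:
  fixes \<epsilon> :: real
  defines "\<rho> \<equiv> \<epsilon> / (28 * ln (20 / \<epsilon>))"
  assumes \<epsilon>: "0 < \<epsilon>" "\<epsilon> < 1 / 10" and \<alpha>: "1500 / \<epsilon>\<^sup>2 \<le> \<alpha>" and d: "d = \<alpha> * ln (real n)"
    and l: "1 \<le> ln (real n)" and n4: "4 \<le> n"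
    and dev: "\<And>v. v \<in> V \<Longrightarrow> \<bar>real (deg E v) - \<alpha> * ln (real n)\<bar> \<le> 2 * sqrt \<alpha> * ln (real n)"
    and rate: "1 + \<epsilon> / 5 \<le> visit_rate \<epsilon> n"
    and v: "v \<in> V" and x: "x \<in> V"
  shows "measure_pmf.prob (lazy_walk E x (nat \<lfloor>(2 + \<epsilon>) * real n * ln (real n)\<rfloor>))
      {xs. length (exits v xs) < nat \<lceil>\<rho> * ln (real n)\<rceil>} \<le> 20 / \<epsilon> * exp (- ((1 + \<epsilon> / 10) * ln (real n)))"
proof -
  let ?l = "ln (real n)" and ?n = "real n"
  define T where "T = mix_time n"
  \<comment> \<open>Long enough that the unmixed part T/s vanishes, short enough that s/n does, so
    further visits within a block remain rare.\<close>
  define s where "s = T\<^sup>2"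
  define L where "L = nat \<lfloor>(2 + \<epsilon>) * ?n * ?l\<rfloor>"
  \<comment> \<open>The factor 1 - \<theta> still leaves mean (1 + \<epsilon>/7) ln n. The price
    \<theta>^(-k) is n^(\<epsilon>/28) up to a constant, and 1/7 - 1/28 > 1/10.\<close>
  define \<theta> where "\<theta> = \<epsilon> / 20"
  define k where "k = nat \<lceil>\<rho> * ?l\<rceil>"
  define \<pi> where "\<pi> = (1 - \<epsilon> / 9) / ?n"
  define p where "p = (real (s - T) * (\<pi> - 2 / ?n\<^sup>2) / 2) /
       (1 + (real T * (6 / (5 * d)) + real s * (8 / (5 * ?n) + 2 / ?n\<^sup>2)) / 2)"
  have T: "456 * ?l \<le> real T" "real T \<le> 456 * ?l + 1"
    using l unfolding T_def mix_time_def by linarith+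
  then have T1: "1 \<le> T" using l by linarith
  then have Ts: "T \<le> s" "0 < s" by (auto simp: s_def power2_eq_square)
  have \<alpha>_pos: "0 < \<alpha>" using \<alpha> \<epsilon> by (smt (verit) divide_pos_pos zero_less_power)
  have Td: "real T * (6 / (5 * d)) \<le> \<epsilon> / 25"
  proof -
    have "real T * (6 / (5 * d)) \<le> (457 * ?l) * (6 / (5 * d))"
      using T l d_pos by (intro mult_right_mono) auto
    also have "\<dots> = 2742 / (5 * \<alpha>)" using l \<alpha>_pos by (simp add: d field_simps)
    also have "\<dots> \<le> 2742 / (5 * (1500 / \<epsilon>\<^sup>2))"
      using \<alpha> \<alpha>_pos \<epsilon> by (intro divide_left_mono mult_left_mono mult_pos_pos) auto
    also have "\<dots> = 2742 / 7500 * (\<epsilon> * \<epsilon>)" by (simp add: power2_eq_square)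
    also have "\<dots> \<le> 2742 / 7500 * (1 / 10 * \<epsilon>)" using \<epsilon> by (intro mult_left_mono mult_right_mono) auto
    finally show ?thesis using \<epsilon> by simp
  qed
  have num: "0 \<le> real (s - T) * (\<pi> - 2 / ?n\<^sup>2) / 2"
  proof -
    have "2 / ?n \<le> 1 / 2" using n4 by (simp add: field_simps)
    then have "2 / ?n \<le> 1 - \<epsilon> / 9" using \<epsilon> by linarith
    then have "2 / ?n / ?n \<le> (1 - \<epsilon> / 9) / ?n" by (rule divide_right_mono) simp
    then show ?thesis by (simp add: \<pi>_def power2_eq_square)
  qed
  \<comment> \<open>\<open>p\<close> with the return term replaced by its upper bound \<epsilon>/25,
    free of \<open>d\<close>, so that it matches \<open>visit_rate\<close>.\<close>
  define p0 where "p0 = (real (s - T) * (\<pi> - 2 / ?n\<^sup>2) / 2) /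
       (1 + \<epsilon> / 50 + real s * (8 / (5 * ?n) + 2 / ?n\<^sup>2) / 2)"
  have p0: "0 \<le> p0" "p0 \<le> p"
  proof -
    have nn: "0 \<le> real s * (8 / (5 * ?n) + 2 / ?n\<^sup>2)" by simp
    show "0 \<le> p0" unfolding p0_def using num nn \<epsilon> by (intro divide_nonneg_nonneg) auto
    have "0 \<le> real T * (6 / (5 * d))" using d_pos by simp
    moreover have "N / (1 + \<epsilon> / 50 + Y / 2) \<le> N / (1 + (X + Y) / 2)"
      if "0 \<le> N" "0 \<le> X" "0 \<le> Y" "X \<le> \<epsilon> / 25" for N X Y :: real
      using that \<epsilon> by (intro divide_left_mono mult_pos_pos add_pos_nonneg) auto
    ultimately show "p0 \<le> p" unfolding p_def p0_def using num nn Td by blast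
  qed
  \<comment> \<open>One -1 for rounding the length of the walk, the other for the incomplete
    block.\<close>
  have div: "((2 + \<epsilon>) * ?n * ?l - 1) / real s - 1 \<le> real (L div s)"
  proof -
    have "(2 + \<epsilon>) * ?n * ?l - 1 \<le> real L" unfolding L_def by linarith
    then have "((2 + \<epsilon>) * ?n * ?l - 1) / real s \<le> real L / real s" by (intro divide_right_mono) auto
    also have "\<dots> \<le> real (L div s) + 1"
    proof -
      have "real L \<le> real (s + s * (L div s))"
        using dividend_less_times_div[OF Ts(2), of L] by linarith
      then show ?thesis using Ts by (simp add: field_simps)
    qed
    finally show ?thesis by simp
  qed
  have "(1 + \<epsilon> / 5) * ?l \<le> visit_rate \<epsilon> n * ?l" using rate l by (intro mult_right_mono) auto
  also have "visit_rate \<epsilon> n * ?l = p0 * (((2 + \<epsilon>) * ?n * ?l - 1) / real s - 1)"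
  proof -
    let ?D = "1 + \<epsilon> / 50 + (8 / 5 * ((real T)\<^sup>2 / ?n) + 2 * ((real T)\<^sup>2 / ?n\<^sup>2)) / 2"
    have "0 < ?D" using \<epsilon> by (intro add_pos_nonneg) auto
    have Teq: "real (s - T) = (real T)\<^sup>2 * (1 - 1 / real T)"
      using Ts(1) T1 by (simp add: of_nat_diff s_def power2_eq_square algebra_simps)
    have D: "1 + \<epsilon> / 50 + real s * (8 / (5 * ?n) + 2 / ?n\<^sup>2) / 2 = ?D"
      by (simp add: s_def algebra_simps)
    have \<pi>': "\<pi> - 2 / ?n\<^sup>2 = ((1 - \<epsilon> / 9) - 2 / ?n) / ?n"
      by (simp add: \<pi>_def power2_eq_square diff_divide_distrib)
    have tail: "((2 + \<epsilon>) * ?n * ?l - 1) / real s - 1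
        = ((2 + \<epsilon>) - 1 / (?n * ?l) - (real T)\<^sup>2 / (?n * ?l)) * (?n * ?l / (real T)\<^sup>2)"
      using T1 n4 l by (simp add: s_def field_simps)
    have gen: "u * w / 2 / D * t * l = t2 * u * (w / N) / 2 / D * (t * (N * l / t2))"
      if "t2 \<noteq> 0" "N \<noteq> 0" for u w D t l t2 N :: real
      using that by (simp add: field_simps)
    show ?thesis
      unfolding p0_def D \<pi>' Teq tail visit_rate_def T_def[symmetric]
      by (rule gen) (use T1 n4 in auto)
  qed
  also have "\<dots> \<le> p0 * real (L div s)" by (rule mult_left_mono[OF div p0(1)])
  also have "\<dots> \<le> p * real (L div s)" using p0(2) by (intro mult_right_mono) auto
  finally have main: "(1 + \<epsilon> / 5) * ?l \<le> p * real (L div s)" .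
  have lnpos: "0 < ln (20 / \<epsilon>)" using \<epsilon> by (simp add: field_simps)
  have \<rho>0: "0 < \<rho>" unfolding \<rho>_def using \<epsilon> lnpos by simp
  have k: "real k \<le> \<rho> * ?l + 1" unfolding k_def using \<rho>0 l by (simp add: of_nat_nat)
  have "\<theta> ^ k * measure_pmf.prob (lazy_walk E x L) {xs. length (exits v xs) < k}
    \<le> exp (- ((1 - \<theta>) * p * real (L div s)))"
  proof (rule few_exits_prob[OF v x Ts _ _ p_def])
    show "2 * sqrt ((1 - 9 / 1024) ^ T) \<le> 2 / ?n\<^sup>2" unfolding T_def by (rule mix_time_error[OF l])
    show "\<pi> \<le> real (deg E v) / total"
      unfolding \<pi>_def using l by (intro stationary_ge[OF \<epsilon>(1) \<alpha> _ dev v]) auto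
  qed (use \<epsilon> in \<open>auto simp: \<theta>_def\<close>)
  also have "\<dots> \<le> exp (- ((1 + \<epsilon> / 7) * ?l))"
  proof -
    define q where "q = \<epsilon> * \<epsilon>"
    have q: "q \<le> 1 / 10 * \<epsilon>" using \<epsilon> unfolding q_def by (intro mult_right_mono) auto
    have e: "(1 - \<theta>) * (1 + \<epsilon> / 5) = 1 + 3 / 20 * \<epsilon> - q / 100"
      unfolding q_def \<theta>_def by (simp add: algebra_simps add_divide_distrib diff_divide_distrib)
    have "1 + \<epsilon> / 7 \<le> (1 - \<theta>) * (1 + \<epsilon> / 5)" unfolding e using q \<epsilon> by linarith
    then have "(1 + \<epsilon> / 7) * ?l \<le> (1 - \<theta>) * (1 + \<epsilon> / 5) * ?l" using l by (intro mult_right_mono) auto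
    also have "\<dots> = (1 - \<theta>) * ((1 + \<epsilon> / 5) * ?l)" by (simp add: mult.assoc)
    also have "\<dots> \<le> (1 - \<theta>) * (p * real (L div s))"
      using main \<epsilon> by (intro mult_left_mono) (auto simp: \<theta>_def)
    finally show ?thesis by (simp add: mult.assoc)
  qed
  finally have 1: "\<theta> ^ k * measure_pmf.prob (lazy_walk E x L) {xs. length (exits v xs) < k}
    \<le> exp (- ((1 + \<epsilon> / 7) * ?l))" .
  have \<theta>k: "(1 / \<theta>) ^ k \<le> 20 / \<epsilon> * exp (\<epsilon> / 28 * ?l)"
  proof -
    have "(1 / \<theta>) ^ k = (20 / \<epsilon>) powr real k" using \<epsilon> by (simp add: \<theta>_def powr_realpow)
    also have "\<dots> \<le> (20 / \<epsilon>) powr (\<rho> * ?l + 1)" using k \<epsilon> by (intro powr_mono) (auto simp: field_simps)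
    also have "\<dots> = exp (\<rho> * ln (20 / \<epsilon>) * ?l) * (20 / \<epsilon>)"
      using \<epsilon> by (simp add: powr_add) (simp add: powr_def mult_ac)
    also have "\<rho> * ln (20 / \<epsilon>) = \<epsilon> / 28" using lnpos by (simp add: \<rho>_def)
    finally show ?thesis by (simp add: mult.commute)
  qed
  have "measure_pmf.prob (lazy_walk E x L) {xs. length (exits v xs) < k}
      = (1 / \<theta>) ^ k * (\<theta> ^ k * measure_pmf.prob (lazy_walk E x L) {xs. length (exits v xs) < k})"
    using \<epsilon> by (simp add: \<theta>_def power_divide)
  also have "\<dots> \<le> (20 / \<epsilon> * exp (\<epsilon> / 28 * ?l)) * exp (- ((1 + \<epsilon> / 7) * ?l))"
    using 1 \<theta>k \<epsilon> by (intro mult_mono) (auto simp: \<theta>_def)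
  also have "\<dots> = 20 / \<epsilon> * exp (\<epsilon> / 28 * ?l - (1 + \<epsilon> / 7) * ?l)"
    by (simp only: mult.assoc mult_exp_exp diff_conv_add_uminus)
  also have "\<dots> \<le> 20 / \<epsilon> * exp (- ((1 + \<epsilon> / 10) * ?l))"
  proof -
    have "0 \<le> \<epsilon> * ?l" using \<epsilon> l by simp
    then have "\<epsilon> / 28 * ?l - (1 + \<epsilon> / 7) * ?l \<le> - ((1 + \<epsilon> / 10) * ?l)" by (simp add: algebra_simps)
    then show ?thesis using \<epsilon> by (intro mult_left_mono) auto
  qed
  finally show ?thesis unfolding k_def L_def .
qed

end

section \<open>Assembly of the bounds and choice of the constants\<close>

text \<open>Chosen so that (20/\<epsilon>)^(\<rho> ln n) equals n^(\<epsilon>/28).\<close>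

definition visit_const :: "real \<Rightarrow> real" where
  "visit_const \<epsilon> = \<epsilon> / (28 * ln (20 / \<epsilon>))"

lemma visit_const_pos: "0 < \<epsilon> \<Longrightarrow> \<epsilon> < 1 / 10 \<Longrightarrow> 0 < visit_const \<epsilon>"
  by (simp add: visit_const_def field_simps)

text \<open>The summands account for some vertex being left too rarely, for (E1) and for
  (E2).\<close>

definition failure_bound :: "real \<Rightarrow> nat \<Rightarrow> real" where
  "failure_bound \<epsilon> n = real n * (20 / \<epsilon> * exp (- ((1 + \<epsilon> / 10) * ln (real n)))) +
     2 * (exp (1 / (real n)\<^sup>2) - 1) + exp (- (real n / ln (real n)))"

lemma failure_bound_tendsto:
  assumes "0 < \<epsilon>"
  shows "failure_bound \<epsilon> \<longlonglongrightarrow> 0"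
proof -
  have "(\<lambda>n. 20 / \<epsilon> * real n powr (- (\<epsilon> / 10))) \<longlonglongrightarrow> 20 / \<epsilon> * 0"
    using assms by (intro tendsto_mult_left tendsto_neg_powr filterlim_real_sequentially) auto
  moreover have "\<forall>\<^sub>F n in sequentially.
      20 / \<epsilon> * real n powr (- (\<epsilon> / 10)) = real n * (20 / \<epsilon> * exp (- ((1 + \<epsilon> / 10) * ln (real n))))"
    using eventually_gt_at_top[of 0]
  proof eventually_elim
    case (elim n)
    have "exp (- ((1 + \<epsilon> / 10) * ln (real n))) = exp (- ln (real n)) * exp (- (\<epsilon> / 10) * ln (real n))"
      unfolding mult_exp_exp by (simp add: algebra_simps)
    then show ?case using elim by (simp add: powr_def exp_minus)
  qed
  ultimately have "(\<lambda>n. real n * (20 / \<epsilon> * exp (- ((1 + \<epsilon> / 10) * ln (real n))))) \<longlonglongrightarrow> 20 / \<epsilon> * 0"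
    by (rule Lim_transform_eventually)
  moreover have "(\<lambda>n. 2 * (exp (1 / (real n)\<^sup>2) - 1)) \<longlonglongrightarrow> 0" by real_asymp
  moreover have "(\<lambda>n. exp (- (real n / ln (real n)))) \<longlonglongrightarrow> 0" by real_asymp
  ultimately have "failure_bound \<epsilon> \<longlonglongrightarrow> 20 / \<epsilon> * 0 + 0 + 0"
    unfolding failure_bound_def[abs_def] by (intro tendsto_add)
  then show ?thesis by simp
qed

text \<open>The size conditions on \<open>n\<close> and the bound itself involve neither the graph
  nor \<alpha> nor the start, which gives convergence along arbitrary sequences.\<close>

lemma prob_trace_ge:
  assumes \<epsilon>: "0 < \<epsilon>" "\<epsilon> < 1 / 10" and \<alpha>: "1500 / \<epsilon>\<^sup>2 \<le> \<alpha>" and pr: "pseudo_random K0 \<alpha> n E"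
    and x: "x \<in> {1..n}"
    and n: "4 \<le> n" "1 \<le> ln (real n)" "1 + \<epsilon> / 5 \<le> visit_rate \<epsilon> n"
      "1 \<le> ln (ln (real n)) powr (3 / 2)"
      "2 * (1 + ln (ln (real n))) + 1 \<le> 3 * visit_const \<epsilon> / 16 * ln (ln (real n)) powr (3 / 2)"
    and K: "K0 \<le> K" "1 < K" "K * ln K \<le> ln (real n)"
      "2 + ln (54 / (5 * ln K)) \<le> - (6 / visit_const \<epsilon>)"
    and \<beta>: "0 < \<beta>" "\<beta> \<le> 1" "11 * K * \<beta> \<le> exp (- (16 / visit_const \<epsilon>))" "\<beta> \<le> visit_const \<epsilon> / 4"
      "\<beta> * (ln (11 * K) + 4 / 3) \<le> 1"
  shows "1 - failure_bound \<epsilon> n \<le> measure_pmf.prob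
     (walk_trace E x (nat \<lfloor>(2 + \<epsilon>) * real n * ln (real n)\<rfloor>)) {\<Gamma>. E1 \<beta> n \<Gamma> \<and> E2 n \<Gamma>}"
proof -
  define d where "d = \<alpha> * ln (real n)"
  define L where "L = nat \<lfloor>(2 + \<epsilon>) * real n * ln (real n)\<rfloor>"
  define k where "k = nat \<lceil>visit_const \<epsilon> * ln (real n)\<rceil>"
  have "1500 * (1::real) \<le> 1500 / \<epsilon>\<^sup>2"
    using \<epsilon> by (simp add: divide_simps power_le_one)
  then have \<alpha>1: "1 \<le> \<alpha>" using \<alpha> by linarith
  have d_pos: "0 < d" using \<alpha>1 n(2) unfolding d_def by (intro mult_pos_pos) auto
  have P2: "\<bar>real (deg E v) - \<alpha> * ln (real n)\<bar> \<le> 2 * sqrt \<alpha> * ln (real n)"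
    "5 / 6 * d \<le> real (deg E v)" "real (deg E v) \<le> 4 / 3 * d" if "v \<in> {1..n}" for v
    using pr that unfolding pseudo_random_def P2_def d_def by (auto simp: mult.assoc)
  interpret expander n E d
  proof
    show "simple_graph n E" using pr by (simp add: pseudo_random_def)
    fix S assume S: "S \<subseteq> {1..n}" "S \<noteq> {}" "2 * card S \<le> n"
    have finS: "finite S" using S finite_subset by blast
    have c: "real (card ({1..n} - S)) = real n - real (card S)"
      using S finS card_mono[OF _ S(1)] by (simp add: card_Diff_subset of_nat_diff)
    have half: "2 * real (card S) \<le> real n" using S(3) by linarith
    have "d / 4 * real (card S) = real (card S) * (real n / 2) * d / (2 * real n)"
      using n(1) by simp
    also have "\<dots> \<le> real (card S) * real (card ({1..n} - S)) * d / (2 * real n)"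
      using half d_pos c by (intro divide_right_mono mult_right_mono mult_left_mono) auto
    also have "\<dots> = real (card S) * real (card ({1..n} - S)) * \<alpha> * ln (real n) / (2 * real n)"
      by (simp add: d_def mult.assoc)
    also have "\<dots> \<le> real (card (edge_boundary n E S))"
    proof -
      have "P3 \<alpha> n E" using pr by (simp add: pseudo_random_def)
      moreover have "S \<subseteq> {1..n} \<and> S \<noteq> {} \<and> real (card S) \<le> 8 / 10 * real n" using S half by simp
      ultimately show ?thesis unfolding P3_def by (blast intro: less_imp_le)
    qed
    finally show "d / 4 * real (card S) \<le> real (card (edge_boundary n E S))" .
  qed (use n d_pos P2 in auto)
  interpret sparse_graph n E d \<alpha> K0
    using pr \<alpha>1 n(2) by unfold_locales (auto simp: d_def pseudo_random_def)
  note \<rho> = visit_const_pos[OF \<epsilon>]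
  have k: "visit_const \<epsilon> * ln (real n) \<le> real k" unfolding k_def by linarith
  let ?p = "measure_pmf.prob (lazy_walk E x L)"
  define few where "few = (\<lambda>v. {xs. length (exits v xs) < k})"
  define bad1 where "bad1 = {xs. (\<forall>v\<in>V. k \<le> length (exits v xs)) \<and> \<not> E1 \<beta> n (trace_of xs)}"
  define bad2 where "bad2 = {xs. (\<forall>v\<in>V. k \<le> length (exits v xs)) \<and> \<not> E2 n (trace_of xs)}"
  have "1 - ?p {xs. E1 \<beta> n (trace_of xs) \<and> E2 n (trace_of xs)} = ?p (- {xs. E1 \<beta> n (trace_of xs) \<and> E2 n (trace_of xs)})"
    by (subst measure_pmf.prob_compl[symmetric]) (auto simp: Compl_eq_Diff_UNIV)
  also have "\<dots> \<le> ?p ((\<Union>v\<in>V. few v) \<union> (bad1 \<union> bad2))"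
    by (intro measure_pmf.finite_measure_mono) (auto simp: few_def bad1_def bad2_def not_le)
  also have "\<dots> \<le> ?p (\<Union>v\<in>V. few v) + ?p (bad1 \<union> bad2)"
    by (rule measure_Un_le) auto
  also have "\<dots> \<le> (\<Sum>v\<in>V. ?p (few v)) + (?p bad1 + ?p bad2)"
    by (intro add_mono measure_UNION_le measure_Un_le) auto
  also have "\<dots> \<le> (\<Sum>v\<in>V. 20 / \<epsilon> * exp (- ((1 + \<epsilon> / 10) * ln (real n)))) +
      (2 * (exp (1 / (real n)\<^sup>2) - 1) + exp (- (real n / ln (real n))))"
  proof (intro add_mono sum_mono)
    fix v assume v: "v \<in> V"
    show "?p (few v) \<le> 20 / \<epsilon> * exp (- ((1 + \<epsilon> / 10) * ln (real n)))"
      unfolding few_def L_def k_def visit_const_def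
      by (rule prob_few_exits[OF \<epsilon> \<alpha> d_def n(2,1) P2(1) n(3) v x])
  next
    show "?p bad1 \<le> 2 * (exp (1 / (real n)\<^sup>2) - 1)"
      unfolding bad1_def by (rule prob_not_E1[OF K \<rho> k \<beta> x])
    have "P5 \<alpha> n E" using pr by (simp add: pseudo_random_def)
    then show "?p bad2 \<le> exp (- (real n / ln (real n)))"
      unfolding bad2_def by (rule prob_not_E2[OF _ n(4,5) \<rho> k x])
  qed
  also have "\<dots> = failure_bound \<epsilon> n" by (simp add: failure_bound_def)
  finally show ?thesis by (simp add: walk_trace_def L_def vimage_def)
qed

theorem theorem3p2:
  fixes K0 :: real
  assumes "K0 > 0"
  shows "\<exists>\<epsilon>0>0. \<forall>\<epsilon>::real. 0 < \<epsilon> \<and> \<epsilon> < \<epsilon>0 \<longrightarrow>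
    (\<exists>\<beta>::real. \<beta> > 0 \<and>
      (\<forall>(\<alpha> :: nat \<Rightarrow> real) (G :: nat \<Rightarrow> nat set set) (v0 :: nat \<Rightarrow> nat).
        (\<forall>\<^sub>F n in sequentially.
            \<alpha> n \<ge> 1500 / \<epsilon>\<^sup>2 \<and> pseudo_random K0 (\<alpha> n) n (G n) \<and> v0 n \<in> {1..n}) \<longrightarrow>
        (\<lambda>n. measure_pmf.prob
               (walk_trace (G n) (v0 n) (nat \<lfloor>(2 + \<epsilon>) * real n * ln (real n)\<rfloor>))
               {\<Gamma>. E1 \<beta> n \<Gamma> \<and> E2 n \<Gamma>}) \<longlonglongrightarrow> 1))"
proof (rule exI[of _ "1 / 10"], intro conjI allI impI)
  fix \<epsilon> :: real assume "0 < \<epsilon> \<and> \<epsilon> < 1 / 10"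
  then have \<epsilon>: "0 < \<epsilon>" "\<epsilon> < 1 / 10" by auto
  define \<rho> where "\<rho> = visit_const \<epsilon>"
  have \<rho>: "0 < \<rho>" unfolding \<rho>_def by (rule visit_const_pos[OF \<epsilon>])
  \<comment> \<open>Solves 54/(5 ln K) <= exp(-(2 + 6/\<rho>)), the fraction of non-light edges that
    \<open>exp_mult_powr_le\<close> can afford.\<close>
  define K where "K = max K0 (exp (54 / 5 * exp (2 + 6 / \<rho>)))"
  have K: "K0 \<le> K" "1 < K" by (auto simp: K_def less_max_iff_disj)
  have lnK: "54 / 5 * exp (2 + 6 / \<rho>) \<le> ln K"
    using K by (subst ln_ge_iff) (auto simp: K_def)
  have K4: "2 + ln (54 / (5 * ln K)) \<le> - (6 / \<rho>)"
  proof -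
    have pos: "0 < ln K" using K by simp
    have "54 / (5 * ln K) \<le> exp (- (2 + 6 / \<rho>))"
      using lnK pos by (simp add: exp_minus divide_simps)
    then have "ln (54 / (5 * ln K)) \<le> ln (exp (- (2 + 6 / \<rho>)))"
      using pos by (subst ln_le_cancel_iff) auto
    then show ?thesis by simp
  qed
  define c where "c = ln (11 * K) + 4 / 3"
  have c: "0 < c" using K ln_gt_zero[of "11 * K"] by (simp add: c_def add_pos_pos)
  \<comment> \<open>The last three entries are the conditions of
    \<open>union_bound_exponent\<close>; 1 keeps the counting parameter in range.\<close>
  define \<beta> where "\<beta> = Min {1, exp (- (16 / \<rho>)) / (11 * K), \<rho> / 4, 1 / c}"
  have "0 < \<beta>" using \<rho> K c by (simp add: \<beta>_def)
  moreover have "\<beta> \<le> 1" "\<beta> \<le> exp (- (16 / \<rho>)) / (11 * K)" "\<beta> \<le> \<rho> / 4" "\<beta> \<le> 1 / c"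
    unfolding \<beta>_def by (auto intro!: Min_le)
  ultimately have \<beta>: "0 < \<beta>" "\<beta> \<le> 1" "11 * K * \<beta> \<le> exp (- (16 / \<rho>))" "\<beta> \<le> \<rho> / 4" "\<beta> * c \<le> 1"
    using K c by (simp_all add: field_simps)
  have large: "\<forall>\<^sub>F n in sequentially. 4 \<le> n \<and> 1 \<le> ln (real n) \<and> 1 + \<epsilon> / 5 \<le> visit_rate \<epsilon> n \<and>
      1 \<le> ln (ln (real n)) powr (3 / 2) \<and>
      2 * (1 + ln (ln (real n))) + 1 \<le> 3 * \<rho> / 16 * ln (ln (real n)) powr (3 / 2) \<and>
      K * ln K \<le> ln (real n)"
  proof (intro eventually_conj eventually_visit_rate[OF \<epsilon>] eventually_ge_at_top)
    show "\<forall>\<^sub>F n in sequentially. 1 \<le> ln (real n)" by real_asymp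
    show "\<forall>\<^sub>F n in sequentially. 1 \<le> ln (ln (real n)) powr (3 / 2)" by real_asymp
    show "\<forall>\<^sub>F n in sequentially.
        2 * (1 + ln (ln (real n))) + 1 \<le> 3 * \<rho> / 16 * ln (ln (real n)) powr (3 / 2)"
      using \<rho> by real_asymp
    have "filterlim (\<lambda>n. ln (real n)) at_top sequentially" by real_asymp
    then show "\<forall>\<^sub>F n in sequentially. K * ln K \<le> ln (real n)" by (simp add: filterlim_at_top)
  qed
  show "\<exists>\<beta>>0. \<forall>\<alpha> G v0.
        (\<forall>\<^sub>F n in sequentially.
            \<alpha> n \<ge> 1500 / \<epsilon>\<^sup>2 \<and> pseudo_random K0 (\<alpha> n) n (G n) \<and> v0 n \<in> {1..n}) \<longrightarrow>
        (\<lambda>n. measure_pmf.prob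
               (walk_trace (G n) (v0 n) (nat \<lfloor>(2 + \<epsilon>) * real n * ln (real n)\<rfloor>))
               {\<Gamma>. E1 \<beta> n \<Gamma> \<and> E2 n \<Gamma>}) \<longlonglongrightarrow> 1"
  proof (intro exI[of _ \<beta>] conjI allI impI)
    fix \<alpha> :: "nat \<Rightarrow> real" and G :: "nat \<Rightarrow> nat set set" and v0 :: "nat \<Rightarrow> nat"
    assume ev: "\<forall>\<^sub>F n in sequentially.
            \<alpha> n \<ge> 1500 / \<epsilon>\<^sup>2 \<and> pseudo_random K0 (\<alpha> n) n (G n) \<and> v0 n \<in> {1..n}"
    let ?p = "\<lambda>n. measure_pmf.prob
               (walk_trace (G n) (v0 n) (nat \<lfloor>(2 + \<epsilon>) * real n * ln (real n)\<rfloor>))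
               {\<Gamma>. E1 \<beta> n \<Gamma> \<and> E2 n \<Gamma>}"
    have "\<forall>\<^sub>F n in sequentially. 1 - failure_bound \<epsilon> n \<le> ?p n"
      using ev large
    proof eventually_elim
      case (elim n)
      then show ?case
        using \<epsilon> K K4 \<beta> unfolding \<rho>_def c_def by (intro prob_trace_ge) auto
    qed
    moreover have "(\<lambda>n. 1 - failure_bound \<epsilon> n) \<longlonglongrightarrow> 1 - 0"
      by (intro tendsto_intros failure_bound_tendsto \<epsilon>)
    ultimately show "?p \<longlonglongrightarrow> 1"
      by (intro tendsto_sandwich[of "\<lambda>n. 1 - failure_bound \<epsilon> n" ?p sequentially "\<lambda>_. 1"]) auto
  qed (rule \<beta>(1))
qed simp

end
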